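(* Fix $\gamma\in(0,1/2)$ and $\beta>0$. Consider the noisy sorting model with parameter $\gamma$, true order $\pi$. There is a constant $C=C(\gamma,\beta)$ such that, except with probability $O(n^{-\beta})$, every optimal ranking $\sigma$ satisfies $$\sum_{i=1}^n|\sigma(i)-\pi(i)|\le Cn \quad\text{and}\quad \max_i|\sigma(i)-\pi(i)|\le C\log n .$$
   Context: There are $n$ items $a_1,\dots,a_n$. There is an unknown true order given by a permutation $\pi$ of $\{1,\dots,n\}$, where $a_i<a_j$ in the true order iff $\pi(i)<\pi(j)$. For every pair $i\neq j$ there is a comparison outcome $q(a_i,a_j)\in\{+1,-1\}$ with $q(a_j,a_i)=-q(a_i,a_j)$. If $\pi(i)>\pi(j)$ then $\Pr[q(a_i,a_j)=+1]\ge\tfrac12+\gamma$. Outcomes for distinct unordered pairs are independent. A ranking is a permutation $\sigma$ of $\{1,\dots,n\}$, with $\sigma(i)$ the position of $a_i$. Its score is $s_q(\sigma)=\sum_{(i,j):\sigma(i)>\sigma(j)}q(a_i,a_j)$. A ranking is optimal if it maximizes $s_q$. *)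

theory Defs
  imports "HOL-Probability.Probability" "HOL-Combinatorics.Permutations"
begin

text \<open>
  Items are identified with their indices \<open>1, \<dots>, n\<close>. A comparison table is a function
  \<open>q\<close> where \<open>q i j = 1\<close> reports that item \<open>i\<close> is ranked above item \<open>j\<close>;
  only its values at distinct \<open>i, j \<in> {1..n}\<close> matter.
\<close>

definition score :: "nat \<Rightarrow> (nat \<Rightarrow> nat \<Rightarrow> int) \<Rightarrow> (nat \<Rightarrow> nat) \<Rightarrow> int" where
  "score n q \<sigma> = (\<Sum>(i, j) \<in> {(i, j). i \<in> {1..n} \<and> j \<in> {1..n} \<and> \<sigma> i > \<sigma> j}. q i j)"

definition optimal_ranking :: "nat \<Rightarrow> (nat \<Rightarrow> nat \<Rightarrow> int) \<Rightarrow> (nat \<Rightarrow> nat) \<Rightarrow> bool" where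
  "optimal_ranking n q \<sigma> \<longleftrightarrow>
     \<sigma> permutes {1..n} \<and> (\<forall>\<tau>. \<tau> permutes {1..n} \<longrightarrow> score n q \<tau> \<le> score n q \<sigma>)"

text \<open>
  The random table \<open>q\<close> lives on an arbitrary probability space \<open>M\<close>. An unordered pair
  is represented by its increasing enumeration \<open>(i, j)\<close>, \<open>i < j\<close>; the outcome at
  \<open>(j, i)\<close> is then determined by antisymmetry. Only a lower bound is imposed on the
  probability of a correct outcome, so the pairs need not be identically distributed.
\<close>

locale noisy_sorting = prob_space M for M :: "'a measure" +
  fixes n :: nat and \<gamma> :: real and \<pi> :: "nat \<Rightarrow> nat" and q :: "'a \<Rightarrow> nat \<Rightarrow> nat \<Rightarrow> int"
  assumes true_order: "\<pi> permutes {1..n}"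
    and outcome: "\<And>\<omega> i j. \<omega> \<in> space M \<Longrightarrow> i \<in> {1..n} \<Longrightarrow> j \<in> {1..n} \<Longrightarrow> i \<noteq> j \<Longrightarrow>
          q \<omega> i j \<in> {1, -1}"
    and antisym: "\<And>\<omega> i j. \<omega> \<in> space M \<Longrightarrow> i \<in> {1..n} \<Longrightarrow> j \<in> {1..n} \<Longrightarrow> i \<noteq> j \<Longrightarrow>
          q \<omega> j i = - q \<omega> i j"
    and indep: "indep_vars (\<lambda>_. count_space UNIV) (\<lambda>(i, j) \<omega>. q \<omega> i j)
          {(i, j). i \<in> {1..n} \<and> j \<in> {1..n} \<and> i < j}"
    and bias: "\<And>i j. i \<in> {1..n} \<Longrightarrow> j \<in> {1..n} \<Longrightarrow> \<pi> i > \<pi> j \<Longrightarrow>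
          prob {\<omega> \<in> space M. q \<omega> i j = 1} \<ge> 1 / 2 + \<gamma>"

end

theory Submission
  imports Defs
begin

text \<open>
  Relabel the items by their true ranks, so that the true order is the identity. For two rankings
  \<open>\<sigma>\<close>, \<open>\<tau>\<close> the score difference is twice the sum of \<open>q\<close> over the pairs that they order
  differently, so optimality of \<open>\<sigma>\<close> forces this sum to be nonnegative. By Hoeffding, the
  comparisons inside a fixed set \<open>E\<close> of pairs fail to be mostly correct with probability at most
  \<open>exp (-\<gamma>\<^sup>2 |E| / 2)\<close>, and each step is a union bound over a suitable family of sets \<open>E\<close>.

  Total deviation: compare \<open>\<sigma>\<close> with the true order, \<open>E\<close> being the inversions of \<open>\<sigma>\<close>. The
  footrule is at most twice the number of inversions, and the sum of \<open>x\<close> to the power of the footrule over all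
  permutations is at most \<open>(2 / (1 - x)) ^ n\<close>, because it is dominated by the sum over all functions.

  Maximal deviation: let \<open>t\<close> be the maximum over all cuts \<open>p\<close> of the number of items that \<open>\<sigma>\<close> carries from
  \<open>{1..p}\<close> to above \<open>p\<close>. The items occupying an interval of positions then differ from the true
  interval by \<open>O(t)\<close> items, so if \<open>t\<close> exceeds a multiple of \<open>ln n\<close>, an item carried further than
  \<open>O(t/\<gamma>)\<close> beyond a cut could profitably be moved back. Hence at the maximising cut all
  inversions across the cut lie within a window of \<open>O(t/\<gamma>)\<close> positions. There are at least \<open>t\<^sup>2\<close> of
  them, while the contents of the window can be chosen in only \<open>exp (O(t/\<gamma>) ln n)\<close> ways, so
  sorting the window across the cut would improve \<open>\<sigma>\<close> unless \<open>t = O(ln n)\<close>. Moving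
  single items once more bounds every displacement by \<open>O(t/\<gamma>)\<close>.
\<close>

subsection \<open>Exchange inequalities for optimal rankings\<close>

text \<open>Each exchange below is specified by a sort key instead of an explicit permutation.
  Counting the keys that do not exceed the key of \<open>i\<close> turns an injective key into a
  ranking.\<close>

lemma exists_permutation_ordered_by:
  fixes f :: "nat \<Rightarrow> 'b::linorder"
  assumes "inj_on f {1..n}"
  obtains \<tau> where "\<tau> permutes {1..n}"
    "\<And>i j. i \<in> {1..n} \<Longrightarrow> j \<in> {1..n} \<Longrightarrow> \<tau> i < \<tau> j \<longleftrightarrow> f i < f j"
proof -
  define \<tau> where "\<tau> i = (if i \<in> {1..n} then card {j \<in> {1..n}. f j \<le> f i} else i)" for i
  have mono: "\<tau> i < \<tau> j" if "i \<in> {1..n}" "j \<in> {1..n}" "f i < f j" for i j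
  proof -
    have "{k \<in> {1..n}. f k \<le> f i} \<subset> {k \<in> {1..n}. f k \<le> f j}"
    proof
      show "{k \<in> {1..n}. f k \<le> f i} \<subseteq> {k \<in> {1..n}. f k \<le> f j}"
        using that by auto
      show "{k \<in> {1..n}. f k \<le> f i} \<noteq> {k \<in> {1..n}. f k \<le> f j}"
        using that by (metis (no_types, lifting) linorder_not_le mem_Collect_eq order_refl)
    qed
    then have "card {k \<in> {1..n}. f k \<le> f i} < card {k \<in> {1..n}. f k \<le> f j}"
      by (intro psubset_card_mono) auto
    then show ?thesis using that by (simp add: \<tau>_def)
  qed
  have iff: "\<tau> i < \<tau> j \<longleftrightarrow> f i < f j" if "i \<in> {1..n}" "j \<in> {1..n}" for i j
    using mono[OF that] mono[OF that(2,1)] inj_onD[OF assms _ that]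
    by (cases "f i" "f j" rule: linorder_cases) auto
  have inj: "inj_on \<tau> {1..n}"
  proof (rule inj_onI)
    fix i j assume ij: "i \<in> {1..n}" "j \<in> {1..n}" and "\<tau> i = \<tau> j"
    then have "f i = f j"
      using iff[OF ij] iff[OF ij(2,1)] by (metis less_irrefl linorder_neqE)
    then show "i = j"
      using inj_onD[OF assms _ ij] by blast
  qed
  have "\<tau> ` {1..n} \<subseteq> {1..n}"
  proof
    fix k assume "k \<in> \<tau> ` {1..n}"
    then obtain i where i: "i \<in> {1..n}" "k = card {j \<in> {1..n}. f j \<le> f i}"
      by (auto simp: \<tau>_def)
    have "card {j \<in> {1..n}. f j \<le> f i} \<le> card {1..n}"
      by (intro card_mono) auto
    moreover have "0 < card {j \<in> {1..n}. f j \<le> f i}"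
      using i by (subst card_gt_0_iff) auto
    ultimately show "k \<in> {1..n}"
      using i by simp
  qed
  then have "bij_betw \<tau> {1..n} {1..n}"
    using inj by (simp add: bij_betw_def endo_inj_surj)
  then have "\<tau> permutes {1..n}"
    by (rule bij_imp_permutes) (auto simp: \<tau>_def)
  then show ?thesis using that iff by blast
qed

lemma permutes_atLeastAtMost_bounds:
  assumes "\<sigma> permutes {1..n::nat}" "x \<in> {1..n}"
  shows "1 \<le> \<sigma> x" "\<sigma> x \<le> n"
  using permutes_in_image[OF assms(1), of x] assms(2) by auto

text \<open>Pairs that both rankings order alike cancel in the score difference. A pair ordered
  differently contributes \<open>r i j\<close> to the score of \<open>\<sigma>\<close> and, by
  antisymmetry, \<open>- r i j\<close> to that of \<open>\<tau>\<close>.\<close>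

lemma optimal_exchange:
  fixes r :: "nat \<Rightarrow> nat \<Rightarrow> int"
  assumes anti: "\<And>i j. i \<in> {1..n} \<Longrightarrow> j \<in> {1..n} \<Longrightarrow> i \<noteq> j \<Longrightarrow> r j i = - r i j"
    and opt: "optimal_ranking n r \<sigma>" and \<tau>: "\<tau> permutes {1..n}"
  shows "0 \<le> (\<Sum>(i, j) \<in> {(i, j). i \<in> {1..n} \<and> j \<in> {1..n} \<and> \<sigma> j < \<sigma> i \<and> \<tau> i < \<tau> j}. r i j)"
    (is "0 \<le> sum _ ?D")
proof -
  define P where "P \<rho> = {(i, j). i \<in> {1..n} \<and> j \<in> {1..n} \<and> \<rho> i > \<rho> j}" for \<rho> :: "nat \<Rightarrow> nat"
  let ?r = "\<lambda>(i, j). r i j"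
  have fin: "finite (P \<rho>)" for \<rho>
    by (rule finite_subset[of _ "{1..n} \<times> {1..n}"]) (auto simp: P_def)
  have \<sigma>: "\<sigma> permutes {1..n}" and score_le: "score n r \<tau> \<le> score n r \<sigma>"
    using opt \<tau> by (auto simp: optimal_ranking_def)
  have inj: "\<tau> i = \<tau> j \<longleftrightarrow> i = j" "\<sigma> i = \<sigma> j \<longleftrightarrow> i = j" for i j
    by (rule inj_eq[OF permutes_inj[OF \<tau>]], rule inj_eq[OF permutes_inj[OF \<sigma>]])
  have le: "\<not> \<tau> j < \<tau> i \<longleftrightarrow> \<tau> i < \<tau> j \<or> i = j" "\<not> \<sigma> j < \<sigma> i \<longleftrightarrow> \<sigma> i < \<sigma> j \<or> i = j" for i j
    using inj[of i j] by linarith+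
  have 1: "P \<sigma> - P \<tau> = ?D"
    unfolding P_def using le by auto
  have 2: "P \<tau> - P \<sigma> = prod.swap ` ?D"
    unfolding P_def using le by (auto simp: image_iff)
  have "sum ?r (P \<tau> - P \<sigma>) = (\<Sum>x\<in>?D. ?r (prod.swap x))"
    unfolding 2 by (subst sum.reindex) auto
  also have "\<dots> = (\<Sum>x\<in>?D. - ?r x)"
    by (intro sum.cong refl) (auto intro!: anti)
  finally have 3: "sum ?r (P \<tau> - P \<sigma>) = - sum ?r ?D"
    by (simp add: sum_negf)
  have "sum ?r (P \<sigma>) = sum ?r (P \<sigma> \<inter> P \<tau>) + sum ?r ?D"
    using sum.Int_Diff[OF fin, of ?r \<sigma> "P \<tau>"] 1 by simp
  moreover have "sum ?r (P \<tau>) = sum ?r (P \<sigma> \<inter> P \<tau>) - sum ?r ?D"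
    using sum.Int_Diff[OF fin, of ?r \<tau> "P \<sigma>"] 3 by (simp add: Int_commute)
  moreover have "score n r \<rho> = sum ?r (P \<rho>)" for \<rho>
    by (simp add: score_def P_def)
  ultimately show ?thesis
    using score_le by simp
qed

text \<open>Take \<open>a\<close> out and reinsert it just before position \<open>s\<close>: only
  the pairs of \<open>a\<close> with the items it jumps over change their order.\<close>

lemma optimal_move_left:
  fixes r :: "nat \<Rightarrow> nat \<Rightarrow> int"
  assumes anti: "\<And>i j. i \<in> {1..n} \<Longrightarrow> j \<in> {1..n} \<Longrightarrow> i \<noteq> j \<Longrightarrow> r j i = - r i j"
    and opt: "optimal_ranking n r \<sigma>" and a: "a \<in> {1..n}" and s: "s \<le> \<sigma> a"
  shows "0 \<le> (\<Sum>x \<in> {x \<in> {1..n}. s \<le> \<sigma> x \<and> \<sigma> x < \<sigma> a}. r a x)"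
proof -
  have \<sigma>: "inj \<sigma>"
    using opt by (auto simp: optimal_ranking_def permutes_inj)
  \<comment> \<open>Doubling the positions frees the odd keys; this one falls strictly between
    positions \<open>s - 1\<close> and \<open>s\<close>.\<close>
  define f where "f x = (if x = a then 2 * int s - 1 else 2 * int (\<sigma> x))" for x
  have "inj_on f {1..n}"
  proof (rule inj_onI)
    fix x y assume "f x = f y"
    moreover have "2 * int u \<noteq> 2 * int v - 1" "2 * int u \<noteq> 2 * int v + 1" for u v
      by presburger+
    ultimately show "x = y"
      using injD[OF \<sigma>, of x y] by (auto simp: f_def split: if_splits) metis+
  qed
  then obtain \<tau> where \<tau>: "\<tau> permutes {1..n}"
      "\<And>i j. i \<in> {1..n} \<Longrightarrow> j \<in> {1..n} \<Longrightarrow> \<tau> i < \<tau> j \<longleftrightarrow> f i < f j"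
    by (rule exists_permutation_ordered_by) blast
  have "{(i, j). i \<in> {1..n} \<and> j \<in> {1..n} \<and> \<sigma> j < \<sigma> i \<and> \<tau> i < \<tau> j}
      = {(i, j). i \<in> {1..n} \<and> j \<in> {1..n} \<and> \<sigma> j < \<sigma> i \<and> f i < f j}"
    using \<tau>(2) by blast
  also have "\<dots> = Pair a ` {x \<in> {1..n}. s \<le> \<sigma> x \<and> \<sigma> x < \<sigma> a}"
    using a s by (auto simp: f_def split: if_splits)
  finally show ?thesis
    using optimal_exchange[OF anti opt \<tau>(1)] by (simp add: sum.reindex inj_on_def)
qed

text \<open>Mirror image of \<open>optimal_move_left\<close>: \<open>a\<close> is reinserted just
  after position \<open>s\<close>.\<close>

lemma optimal_move_right:
  fixes r :: "nat \<Rightarrow> nat \<Rightarrow> int"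
  assumes anti: "\<And>i j. i \<in> {1..n} \<Longrightarrow> j \<in> {1..n} \<Longrightarrow> i \<noteq> j \<Longrightarrow> r j i = - r i j"
    and opt: "optimal_ranking n r \<sigma>" and a: "a \<in> {1..n}" and s: "\<sigma> a \<le> s"
  shows "0 \<le> (\<Sum>x \<in> {x \<in> {1..n}. \<sigma> a < \<sigma> x \<and> \<sigma> x \<le> s}. r x a)"
proof -
  have \<sigma>: "inj \<sigma>"
    using opt by (auto simp: optimal_ranking_def permutes_inj)
  define f where "f x = (if x = a then 2 * int s + 1 else 2 * int (\<sigma> x))" for x
  have "inj_on f {1..n}"
  proof (rule inj_onI)
    fix x y assume "f x = f y"
    moreover have "2 * int u \<noteq> 2 * int v - 1" "2 * int u \<noteq> 2 * int v + 1" for u v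
      by presburger+
    ultimately show "x = y"
      using injD[OF \<sigma>, of x y] by (auto simp: f_def split: if_splits) metis+
  qed
  then obtain \<tau> where \<tau>: "\<tau> permutes {1..n}"
      "\<And>i j. i \<in> {1..n} \<Longrightarrow> j \<in> {1..n} \<Longrightarrow> \<tau> i < \<tau> j \<longleftrightarrow> f i < f j"
    by (rule exists_permutation_ordered_by) blast
  have "{(i, j). i \<in> {1..n} \<and> j \<in> {1..n} \<and> \<sigma> j < \<sigma> i \<and> \<tau> i < \<tau> j}
      = {(i, j). i \<in> {1..n} \<and> j \<in> {1..n} \<and> \<sigma> j < \<sigma> i \<and> f i < f j}"
    using \<tau>(2) by blast
  also have "\<dots> = (\<lambda>x. (x, a)) ` {x \<in> {1..n}. \<sigma> a < \<sigma> x \<and> \<sigma> x \<le> s}"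
    using a s by (auto simp: f_def split: if_splits)
  finally show ?thesis
    using optimal_exchange[OF anti opt \<tau>(1)] by (simp add: sum.reindex inj_on_def)
qed

text \<open>The competitor puts all items up to \<open>p\<close> before all later ones and keeps the
  order of \<open>\<sigma>\<close> within both groups, so it undoes exactly the inversions
  straddling the cut.\<close>

lemma optimal_sort_across_cut:
  fixes r :: "nat \<Rightarrow> nat \<Rightarrow> int"
  assumes anti: "\<And>i j. i \<in> {1..n} \<Longrightarrow> j \<in> {1..n} \<Longrightarrow> i \<noteq> j \<Longrightarrow> r j i = - r i j"
    and opt: "optimal_ranking n r \<sigma>"
  shows "0 \<le> (\<Sum>(a, b) \<in> {(a, b). a \<in> {1..n} \<and> b \<in> {1..n} \<and> a \<le> p \<and> p < b \<and> \<sigma> b < \<sigma> a}. r a b)"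
proof -
  have p: "\<sigma> permutes {1..n}"
    using opt by (auto simp: optimal_ranking_def)
  have \<sigma>: "\<sigma> x = \<sigma> y \<longleftrightarrow> x = y" for x y
    by (rule inj_eq[OF permutes_inj[OF p]])
  define f where "f x = (if x \<le> p then \<sigma> x else n + \<sigma> x)" for x
  have range: "0 < \<sigma> x" "\<sigma> x \<le> n" if "x \<in> {1..n}" for x
    using permutes_in_image[OF p, of x] that by auto
  have "inj_on f {1..n}"
  proof (rule inj_onI)
    fix x y assume "x \<in> {1..n}" "y \<in> {1..n}" "f x = f y"
    then show "x = y"
      using \<sigma>[of x y] range[of x] range[of y] by (auto simp: f_def split: if_splits)
  qed
  then obtain \<tau> where \<tau>: "\<tau> permutes {1..n}"
      "\<And>i j. i \<in> {1..n} \<Longrightarrow> j \<in> {1..n} \<Longrightarrow> \<tau> i < \<tau> j \<longleftrightarrow> f i < f j"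
    by (rule exists_permutation_ordered_by) blast
  have "(i \<in> {1..n} \<and> j \<in> {1..n} \<and> \<sigma> j < \<sigma> i \<and> \<tau> i < \<tau> j) \<longleftrightarrow>
      (i \<in> {1..n} \<and> j \<in> {1..n} \<and> i \<le> p \<and> p < j \<and> \<sigma> j < \<sigma> i)" for i j
    using \<tau>(2)[of i j] range[of i] range[of j] by (auto simp: f_def split: if_splits)
  then show ?thesis
    using optimal_exchange[OF anti opt \<tau>(1)] by simp
qed

lemma optimal_sort_all:
  fixes r :: "nat \<Rightarrow> nat \<Rightarrow> int"
  assumes anti: "\<And>i j. i \<in> {1..n} \<Longrightarrow> j \<in> {1..n} \<Longrightarrow> i \<noteq> j \<Longrightarrow> r j i = - r i j"
    and opt: "optimal_ranking n r \<sigma>"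
  shows "0 \<le> (\<Sum>(a, b) \<in> {(a, b). a \<in> {1..n} \<and> b \<in> {1..n} \<and> a < b \<and> \<sigma> b < \<sigma> a}. r a b)"
  using optimal_exchange[OF anti opt permutes_id] by (simp add: conj_ac)

subsection \<open>Items crossing a cut\<close>

definition crossings :: "nat \<Rightarrow> (nat \<Rightarrow> nat) \<Rightarrow> nat \<Rightarrow> nat" where
  "crossings n \<sigma> p = card {x \<in> {1..n}. x \<le> p \<and> p < \<sigma> x}"

text \<open>The items ranked up to \<open>p\<close> and the items placed in the first
  \<open>p\<close> positions are equally many; removing their common part \<open>?S\<close> leaves
  the upward and the downward crossings.\<close>

lemma crossings_eq_downward:
  assumes \<sigma>: "\<sigma> permutes {1..n}" and p: "p \<le> n"
  shows "card {x \<in> {1..n}. p < x \<and> \<sigma> x \<le> p} = crossings n \<sigma> p"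
proof -
  let ?U = "{x \<in> {1..n}. x \<le> p \<and> p < \<sigma> x}" and ?D = "{x \<in> {1..n}. p < x \<and> \<sigma> x \<le> p}"
    and ?S = "{x \<in> {1..n}. x \<le> p \<and> \<sigma> x \<le> p}"
  have im: "\<sigma> ` (?D \<union> ?S) = {1..p}"
  proof
    show "\<sigma> ` (?D \<union> ?S) \<subseteq> {1..p}"
      using permutes_atLeastAtMost_bounds[OF \<sigma>] by auto
    show "{1..p} \<subseteq> \<sigma> ` (?D \<union> ?S)"
    proof
      fix y assume y: "y \<in> {1..p}"
      then have "y \<in> \<sigma> ` {1..n}"
        using p permutes_image[OF \<sigma>] by auto
      then obtain x where "x \<in> {1..n}" "y = \<sigma> x" by blast
      with y show "y \<in> \<sigma> ` (?D \<union> ?S)" by auto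
    qed
  qed
  have "card (?D \<union> ?S) = p"
    using card_image[OF inj_on_subset[OF permutes_inj[OF \<sigma>] subset_UNIV], of "?D \<union> ?S"] im by simp
  moreover have "card (?D \<union> ?S) = card ?D + card ?S"
    by (intro card_Un_disjoint) auto
  moreover have "?U \<union> ?S = {1..p}"
    using p by auto
  then have "card (?U \<union> ?S) = p" by simp
  moreover have "card (?U \<union> ?S) = card ?U + card ?S"
    by (intro card_Un_disjoint) auto
  ultimately show ?thesis
    by (simp add: crossings_def)
qed

text \<open>An item in only one of the two index sets crosses the cut \<open>s - 1\<close> or the
  cut \<open>e\<close>. Each of the four combinations of cut and direction accounts for at most
  \<open>t\<close> items. The bound on \<open>f\<close> is asked only on these sets because
  \<open>f\<close> will be a row or column of a table with uncontrolled diagonal.\<close>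

lemma sum_position_interval_close:
  fixes f :: "nat \<Rightarrow> int"
  assumes \<sigma>: "\<sigma> permutes {1..n}" and t: "\<And>p. p \<le> n \<Longrightarrow> crossings n \<sigma> p \<le> t"
    and s: "1 \<le> s" and e: "s \<le> e" "e \<le> n"
    and f: "\<And>x. x \<in> {1..n} \<Longrightarrow> x \<in> {s..e} \<or> \<sigma> x \<in> {s..e} \<Longrightarrow> \<bar>f x\<bar> \<le> 1"
  shows "\<bar>(\<Sum>x \<in> {x \<in> {1..n}. \<sigma> x \<in> {s..e}}. f x) - (\<Sum>x \<in> {s..e}. f x)\<bar> \<le> 4 * int t"
proof -
  let ?X = "{x \<in> {1..n}. \<sigma> x \<in> {s..e}}" and ?I = "{s..e}"
  let ?U = "\<lambda>p. {x \<in> {1..n}. x \<le> p \<and> p < \<sigma> x}" and ?D = "\<lambda>p. {x \<in> {1..n}. p < x \<and> \<sigma> x \<le> p}"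
  have U: "card (?U p) \<le> t" if "p \<le> n" for p
    using t[OF that] by (simp add: crossings_def)
  have D: "card (?D p) \<le> t" if "p \<le> n" for p
    using t[OF that] crossings_eq_downward[OF \<sigma> that] by simp
  have le: "s - 1 \<le> n" "e \<le> n" using e by auto
  have "card (?X - ?I) \<le> card (?U (s - 1) \<union> ?D e)"
    using s e by (intro card_mono) auto
  also have "\<dots> \<le> card (?U (s - 1)) + card (?D e)"
    by (rule card_Un_le)
  finally have XI: "card (?X - ?I) \<le> 2 * t"
    using U[OF le(1)] D[OF le(2)] by linarith
  have "card (?I - ?X) \<le> card (?D (s - 1) \<union> ?U e)"
    using s e by (intro card_mono) auto
  also have "\<dots> \<le> card (?D (s - 1)) + card (?U e)"
    by (rule card_Un_le)
  finally have IX: "card (?I - ?X) \<le> 2 * t"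
    using D[OF le(1)] U[OF le(2)] by linarith
  have bound: "\<bar>sum f A\<bar> \<le> int (card A)" if "A \<subseteq> ?X \<union> ?I" for A
  proof -
    have "\<bar>f x\<bar> \<le> 1" if "x \<in> A" for x
      using f[of x] that \<open>A \<subseteq> ?X \<union> ?I\<close> s e by force
    then have "(\<Sum>x\<in>A. \<bar>f x\<bar>) \<le> int (card A)"
      using sum_mono[of A "\<lambda>x. \<bar>f x\<bar>" "\<lambda>_. 1"] by simp
    then show ?thesis
      using sum_abs[of f A] by linarith
  qed
  have "sum f ?X = sum f (?X \<inter> ?I) + sum f (?X - ?I)" "sum f ?I = sum f (?X \<inter> ?I) + sum f (?I - ?X)"
    using sum.Int_Diff[of ?X f ?I] sum.Int_Diff[of ?I f ?X] by (simp_all add: Int_commute)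
  moreover have "\<bar>sum f (?X - ?I)\<bar> \<le> 2 * int t" "\<bar>sum f (?I - ?X)\<bar> \<le> 2 * int t"
    using bound[OF le_supI1[OF Diff_subset], of ?I] bound[OF le_supI2[OF Diff_subset], of ?X] XI IX
    by linarith+
  ultimately show ?thesis by linarith
qed

text \<open>\<open>\<sigma> i - i\<close> is the number of later items moved before \<open>i\<close>
  minus the number of earlier items moved after it. Each inversion is seen once from either end,
  hence the factor 2.\<close>

lemma footrule_le_inversions:
  assumes \<sigma>: "\<sigma> permutes {1..n}"
  shows "(\<Sum>i = 1..n. \<bar>int (\<sigma> i) - int i\<bar>)
    \<le> 2 * int (card {(a, b). a \<in> {1..n} \<and> b \<in> {1..n} \<and> a < b \<and> \<sigma> b < \<sigma> a})"
proof -
  let ?E = "{(a, b). a \<in> {1..n} \<and> b \<in> {1..n} \<and> a < b \<and> \<sigma> b < \<sigma> a}"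
  let ?R = "\<lambda>i. {j \<in> {1..n}. i < j \<and> \<sigma> j < \<sigma> i}" and ?L = "\<lambda>i. {j \<in> {1..n}. j < i \<and> \<sigma> i < \<sigma> j}"
  have im: "\<sigma> ` {j \<in> {1..n}. \<sigma> j < \<sigma> i} = {1..<\<sigma> i}" if "i \<in> {1..n}" for i
  proof
    show "\<sigma> ` {j \<in> {1..n}. \<sigma> j < \<sigma> i} \<subseteq> {1..<\<sigma> i}"
      using permutes_atLeastAtMost_bounds[OF \<sigma>] by auto
    show "{1..<\<sigma> i} \<subseteq> \<sigma> ` {j \<in> {1..n}. \<sigma> j < \<sigma> i}"
    proof
      fix y assume y: "y \<in> {1..<\<sigma> i}"
      then have "y \<in> \<sigma> ` {1..n}"
        using permutes_atLeastAtMost_bounds[OF \<sigma>, of i] that permutes_image[OF \<sigma>] by auto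
      then obtain x where "x \<in> {1..n}" "y = \<sigma> x" by blast
      with y show "y \<in> \<sigma> ` {j \<in> {1..n}. \<sigma> j < \<sigma> i}" by auto
    qed
  qed
  have "\<bar>int (\<sigma> i) - int i\<bar> \<le> int (card (?R i)) + int (card (?L i))" if i: "i \<in> {1..n}" for i
  proof -
    let ?S = "{j \<in> {1..n}. j < i \<and> \<sigma> j < \<sigma> i}"
    have eq: "\<sigma> x = \<sigma> y \<longleftrightarrow> x = y" for x y
      by (rule inj_eq[OF permutes_inj[OF \<sigma>]])
    have "?R i \<union> ?S = {j \<in> {1..n}. \<sigma> j < \<sigma> i}"
      using eq by (auto simp: not_less order_le_less)
    then have "card (?R i \<union> ?S) = \<sigma> i - 1"
      using card_image[OF inj_on_subset[OF permutes_inj[OF \<sigma>] subset_UNIV], of "?R i \<union> ?S"] im[OF i] by simp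
    moreover have "card (?R i \<union> ?S) = card (?R i) + card ?S"
      by (intro card_Un_disjoint) auto
    moreover have "?L i \<union> ?S = {1..<i}"
    proof
      show "{1..<i} \<subseteq> ?L i \<union> ?S"
      proof
        fix x assume "x \<in> {1..<i}"
        with i eq[of x i] show "x \<in> ?L i \<union> ?S" by auto
      qed
    qed auto
    then have "card (?L i \<union> ?S) = i - 1" by simp
    moreover have "card (?L i \<union> ?S) = card (?L i) + card ?S"
      by (intro card_Un_disjoint) auto
    moreover have "1 \<le> \<sigma> i" "1 \<le> i"
      using permutes_atLeastAtMost_bounds[OF \<sigma> i] i by auto
    ultimately show ?thesis by linarith
  qed
  then have "(\<Sum>i = 1..n. \<bar>int (\<sigma> i) - int i\<bar>) \<le> (\<Sum>i = 1..n. int (card (?R i)) + int (card (?L i)))"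
    by (intro sum_mono) auto
  also have "\<dots> = int (\<Sum>i = 1..n. card (?R i)) + int (\<Sum>i = 1..n. card (?L i))"
    by (simp add: sum.distrib)
  also have "(\<Sum>i = 1..n. card (?R i)) = card (Sigma {1..n} ?R)"
    by (rule card_SigmaI[symmetric]) auto
  also have "Sigma {1..n} ?R = ?E"
    by auto
  also have "(\<Sum>i = 1..n. card (?L i)) = card (Sigma {1..n} ?L)"
    by (rule card_SigmaI[symmetric]) auto
  also have "Sigma {1..n} ?L = prod.swap ` ?E"
    by (auto simp: image_iff)
  also have "card (prod.swap ` ?E) = card ?E"
    by (rule card_image) simp
  finally show ?thesis by simp
qed

subsection \<open>Displacements in optimal rankings\<close>

text \<open>
  The list \<open>xs\<close> holds the items of a window in the order of \<open>\<sigma>\<close>; it determines the inversions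
  across the cut \<open>p\<close>, so the union bound can range over lists.
\<close>
definition cut_inversions :: "nat list \<Rightarrow> nat \<Rightarrow> (nat \<times> nat) set" where
  "cut_inversions xs p = {(a, b). a \<le> p \<and> p < b \<and> (\<exists>k < length xs. \<exists>l < k. xs ! l = b \<and> xs ! k = a)}"

lemma cut_inversions_subset:
  assumes "set xs \<subseteq> {1..n}"
  shows "cut_inversions xs p \<subseteq> {(a, b). a \<in> {1..n} \<and> b \<in> {1..n} \<and> a < b}"
proof
  fix z assume "z \<in> cut_inversions xs p"
  then obtain k l where "k < length xs" "l < k" and z: "z = (xs ! k, xs ! l)" "xs ! k \<le> p" "p < xs ! l"
    by (auto simp: cut_inversions_def)
  then have "xs ! k \<in> set xs" "xs ! l \<in> set xs" by simp_all
  then have "xs ! k \<in> {1..n}" "xs ! l \<in> {1..n}" using assms by blast+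
  with z show "z \<in> {(a, b). a \<in> {1..n} \<and> b \<in> {1..n} \<and> a < b}" by simp
qed

locale optimal_table =
  fixes n :: nat and r :: "nat \<Rightarrow> nat \<Rightarrow> int" and \<sigma> :: "nat \<Rightarrow> nat"
  assumes table: "\<And>i j. i \<in> {1..n} \<Longrightarrow> j \<in> {1..n} \<Longrightarrow> i \<noteq> j \<Longrightarrow> r i j \<in> {1, -1}"
    and anti: "\<And>i j. i \<in> {1..n} \<Longrightarrow> j \<in> {1..n} \<Longrightarrow> i \<noteq> j \<Longrightarrow> r j i = - r i j"
    and opt: "optimal_ranking n r \<sigma>"
begin

section \<open>Moving a single item of an optimal ranking\<close>

lemma perm: "\<sigma> permutes {1..n}"
  using opt by (simp add: optimal_ranking_def)

lemmas bounds = permutes_atLeastAtMost_bounds[OF perm]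

text \<open>By optimality, moving \<open>a\<close> back to position \<open>s\<close> gains nothing.
  Up to an error \<open>4 * t\<close>, the items jumped over are those ranked \<open>s\<close> to
  \<open>\<sigma> a - 1\<close>, all truly above \<open>a\<close>, so a correct majority among them
  forces the move to be short.\<close>

lemma right_displacement_less:
  assumes t: "\<And>p. p \<le> n \<Longrightarrow> crossings n \<sigma> p \<le> t"
    and a: "a \<in> {1..n}" and s: "a < s" "s < \<sigma> a"
    and good: "\<gamma> * real (\<sigma> a - s) < real_of_int (\<Sum>x \<in> {s..\<sigma> a - 1}. r x a)"
  shows "\<gamma> * real (\<sigma> a - s) < 4 * real t"
proof -
  have le: "1 \<le> s" "s \<le> \<sigma> a - 1" "\<sigma> a - 1 \<le> n"
    using s bounds[OF a] by auto
  have set_eq: "{x \<in> {1..n}. \<sigma> x \<in> {s..\<sigma> a - 1}} = {x \<in> {1..n}. s \<le> \<sigma> x \<and> \<sigma> x < \<sigma> a}"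
    using s by auto
  have "0 \<le> (\<Sum>x \<in> {x \<in> {1..n}. s \<le> \<sigma> x \<and> \<sigma> x < \<sigma> a}. r a x)"
    by (rule optimal_move_left[OF anti opt a]) (use s in auto)
  moreover have "\<bar>(\<Sum>x \<in> {x \<in> {1..n}. \<sigma> x \<in> {s..\<sigma> a - 1}}. r a x) - (\<Sum>x \<in> {s..\<sigma> a - 1}. r a x)\<bar> \<le> 4 * int t"
  proof (rule sum_position_interval_close[OF perm t le])
    fix x assume x: "x \<in> {1..n}" and "x \<in> {s..\<sigma> a - 1} \<or> \<sigma> x \<in> {s..\<sigma> a - 1}"
    then have "x \<noteq> a" using s by auto
    then show "\<bar>r a x\<bar> \<le> 1" using table[OF a x] by auto
  qed auto
  moreover have "(\<Sum>x \<in> {s..\<sigma> a - 1}. r a x) = (\<Sum>x \<in> {s..\<sigma> a - 1}. - r x a)"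
    using s a bounds[OF a] by (intro sum.cong refl anti) auto
  ultimately have "(\<Sum>x \<in> {s..\<sigma> a - 1}. r x a) \<le> 4 * int t"
    unfolding set_eq by (simp add: sum_negf)
  then have "real_of_int (\<Sum>x \<in> {s..\<sigma> a - 1}. r x a) \<le> real_of_int (4 * int t)"
    by (simp only: of_int_le_iff)
  with good show ?thesis by simp
qed

text \<open>The reflected argument: \<open>a\<close> moves forward to position \<open>e\<close>,
  over items that are truly below it up to the same error.\<close>

lemma left_displacement_less:
  assumes t: "\<And>p. p \<le> n \<Longrightarrow> crossings n \<sigma> p \<le> t"
    and a: "a \<in> {1..n}" and e: "\<sigma> a < e" "e < a"
    and good: "\<gamma> * real (e - \<sigma> a) < real_of_int (\<Sum>x \<in> {\<sigma> a + 1..e}. r a x)"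
  shows "\<gamma> * real (e - \<sigma> a) < 4 * real t"
proof -
  have le: "1 \<le> \<sigma> a + 1" "\<sigma> a + 1 \<le> e" "e \<le> n"
    using e a by auto
  have set_eq: "{x \<in> {1..n}. \<sigma> x \<in> {\<sigma> a + 1..e}} = {x \<in> {1..n}. \<sigma> a < \<sigma> x \<and> \<sigma> x \<le> e}"
    by auto
  have "0 \<le> (\<Sum>x \<in> {x \<in> {1..n}. \<sigma> a < \<sigma> x \<and> \<sigma> x \<le> e}. r x a)"
    by (rule optimal_move_right[OF anti opt a]) (use e in auto)
  moreover have "\<bar>(\<Sum>x \<in> {x \<in> {1..n}. \<sigma> x \<in> {\<sigma> a + 1..e}}. r x a) - (\<Sum>x \<in> {\<sigma> a + 1..e}. r x a)\<bar> \<le> 4 * int t"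
  proof (rule sum_position_interval_close[OF perm t le])
    fix x assume x: "x \<in> {1..n}" and "x \<in> {\<sigma> a + 1..e} \<or> \<sigma> x \<in> {\<sigma> a + 1..e}"
    then have "x \<noteq> a" using e by auto
    then show "\<bar>r x a\<bar> \<le> 1" using table[OF x a] by auto
  qed auto
  moreover have "(\<Sum>x \<in> {\<sigma> a + 1..e}. r x a) = (\<Sum>x \<in> {\<sigma> a + 1..e}. - r a x)"
    using e a by (intro sum.cong refl anti) auto
  ultimately have "(\<Sum>x \<in> {\<sigma> a + 1..e}. r a x) \<le> 4 * int t"
    unfolding set_eq by (simp add: sum_negf)
  then have "real_of_int (\<Sum>x \<in> {\<sigma> a + 1..e}. r a x) \<le> real_of_int (4 * int t)"
    by (simp only: of_int_le_iff)
  with good show ?thesis by simp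
qed

end

text \<open>What the maximal displacement bound needs from the random outcome. \<open>L\<close> is
  the length from which intervals of ranks compare reliably with a single item; \<open>D\<close> is
  the number of inversions per window item from which a window is reliable.\<close>

locale good_table = optimal_table +
  fixes \<gamma> L D :: real
  assumes \<gamma>: "0 < \<gamma>" "\<gamma> < 1" and L: "0 < L"
    and good_above: "\<And>a s e. 1 \<le> a \<Longrightarrow> a < s \<Longrightarrow> s \<le> e \<Longrightarrow> e \<le> n \<Longrightarrow> L \<le> real (e + 1 - s) \<Longrightarrow>
      \<gamma> * real (e + 1 - s) < real_of_int (\<Sum>x \<in> {s..e}. r x a)"
    and good_below: "\<And>a s e. 1 \<le> s \<Longrightarrow> s \<le> e \<Longrightarrow> e < a \<Longrightarrow> a \<le> n \<Longrightarrow> L \<le> real (e + 1 - s) \<Longrightarrow>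
      \<gamma> * real (e + 1 - s) < real_of_int (\<Sum>x \<in> {s..e}. r a x)"
    and good_cut: "\<And>xs p. set xs \<subseteq> {1..n} \<Longrightarrow> xs \<noteq> [] \<Longrightarrow> length xs \<le> n \<Longrightarrow> p \<le> n \<Longrightarrow>
      D * real (length xs) \<le> real (card (cut_inversions xs p)) \<Longrightarrow>
      0 < (\<Sum>(a, b) \<in> cut_inversions xs p. r b a)"
begin

text \<open>Overshooting \<open>s\<close> by less than \<open>L\<close> is covered by
  \<open>L \<le> K\<close>; a larger overshoot is bounded by
  \<open>right_displacement_less\<close>.\<close>

lemma right_displacement_le:
  assumes t: "\<And>p. p \<le> n \<Longrightarrow> crossings n \<sigma> p \<le> t" and K: "L \<le> K" "4 * real t / \<gamma> \<le> K"
    and a: "a \<in> {1..n}" and s: "a < s"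
  shows "real (\<sigma> a) \<le> real s + K"
proof (cases "s < \<sigma> a \<and> L \<le> real (\<sigma> a - s)")
  case True
  then have eq: "\<sigma> a - 1 + 1 - s = \<sigma> a - s" by simp
  have "\<gamma> * real (\<sigma> a - 1 + 1 - s) < real_of_int (\<Sum>x \<in> {s..\<sigma> a - 1}. r x a)"
    by (rule good_above) (use True a s bounds[OF a] in \<open>auto simp: eq\<close>)
  then have "\<gamma> * real (\<sigma> a - s) < 4 * real t"
    unfolding eq using right_displacement_less[OF t a s] True by blast
  then have "real (\<sigma> a - s) < 4 * real t / \<gamma>"
    using \<gamma> by (simp add: pos_less_divide_eq mult.commute)
  then show ?thesis using True K by (simp add: of_nat_diff)
next
  case False
  then show ?thesis using K L by (auto simp: of_nat_diff)
qed

lemma left_displacement_le: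
  assumes t: "\<And>p. p \<le> n \<Longrightarrow> crossings n \<sigma> p \<le> t" and K: "L \<le> K" "4 * real t / \<gamma> \<le> K"
    and a: "a \<in> {1..n}" and e: "e < a"
  shows "real e \<le> real (\<sigma> a) + K"
proof (cases "\<sigma> a < e \<and> L \<le> real (e - \<sigma> a)")
  case True
  have eq: "e + 1 - (\<sigma> a + 1) = e - \<sigma> a" by simp
  have "\<gamma> * real (e + 1 - (\<sigma> a + 1)) < real_of_int (\<Sum>x \<in> {\<sigma> a + 1..e}. r a x)"
    by (rule good_below, unfold eq) (use True a e in auto)
  then have "\<gamma> * real (e - \<sigma> a) < 4 * real t"
    unfolding eq using left_displacement_less[OF t a _ e] True by blast
  then have "real (e - \<sigma> a) < 4 * real t / \<gamma>"
    using \<gamma> by (simp add: pos_less_divide_eq mult.commute)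
  then show ?thesis using True K by (simp add: of_nat_diff)
next
  case False
  then show ?thesis using K L by (auto simp: of_nat_diff)
qed

lemma crossing_inversions_in_window:
  assumes a: "a \<in> {1..n}" "a \<le> p" and b: "b \<in> {1..n}" "p < b" and ab: "\<sigma> b < \<sigma> a"
    and hi: "\<And>x. x \<in> {1..n} \<Longrightarrow> x \<le> p \<Longrightarrow> \<sigma> x \<le> hi" and lo: "\<And>x. x \<in> {1..n} \<Longrightarrow> p < x \<Longrightarrow> lo \<le> \<sigma> x"
  shows "\<sigma> a \<in> {lo..hi}" "\<sigma> b \<in> {lo..hi}"
  using hi[OF a] lo[OF b] ab by auto

text \<open>With \<open>t\<close> the maximal number of crossings, at least \<open>t * t\<close>
  inversions lie in a window of at most \<open>10 * t / \<gamma>\<close> items, a density of at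
  least \<open>\<gamma> * t / 10\<close>. Once this exceeds \<open>D\<close>,
  \<open>good_cut\<close> contradicts \<open>optimal_sort_across_cut\<close>.\<close>

lemma crossings_le:
  assumes p: "p \<le> n"
  shows "real (crossings n \<sigma> p) \<le> max L (10 * D / \<gamma>)"
proof -
  define t where "t = Max (crossings n \<sigma> ` {..n})"
  have t: "crossings n \<sigma> p \<le> t" if "p \<le> n" for p
    unfolding t_def using that by (intro Max_ge) auto
  have "t \<in> crossings n \<sigma> ` {..n}"
    unfolding t_def by (intro Max_in) auto
  then obtain c where c: "c \<le> n" "crossings n \<sigma> c = t" by auto
  have "real t \<le> max L (10 * D / \<gamma>)"
  proof (rule ccontr)
    assume "\<not> ?thesis"
    then have tL: "L < real t" and tD: "10 * D / \<gamma> < real t" by auto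
    then have t1: "1 \<le> t" using L by (cases t) auto
    \<comment> \<open>The reach of a single-item move. As \<open>\<gamma> < 1\<close>, it is at
      least \<open>t\<close>, hence at least \<open>L\<close>.\<close>
    define K where "K = 4 * real t / \<gamma>"
    have tK: "real t \<le> K"
      using \<gamma> mult_right_mono[of \<gamma> 4 "real t"] by (simp add: K_def field_simps)
    then have K: "L \<le> K" "4 * real t / \<gamma> \<le> K" using tL by (auto simp: K_def)
    define w where "w = nat \<lfloor>K\<rfloor>"
    have w: "real k \<le> K \<Longrightarrow> k \<le> w" for k
      unfolding w_def by (simp add: le_nat_floor)
    have wK: "real w \<le> K"
      unfolding w_def using tK by (simp add: of_nat_floor)
    \<comment> \<open>The extra 1 at the upper end arises because an item ranked \<open>c\<close>
      can only be compared with ranks from \<open>c + 1\<close> on, whereas items above the cut can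
      be compared with ranks up to \<open>c\<close>.\<close>
    define hi where "hi = min n (c + 1 + w)"
    define lo where "lo = max 1 (c - w)"
    have hi: "\<sigma> x \<le> hi" if "x \<in> {1..n}" "x \<le> c" for x
    proof -
      have "real (\<sigma> x) \<le> real (c + 1) + K"
        using right_displacement_le[OF t K that(1), of "c + 1"] that(2) by simp
      then have "\<sigma> x - (c + 1) \<le> w"
        using tK by (intro w) (cases "\<sigma> x \<le> c + 1"; simp add: of_nat_diff)
      then show ?thesis using bounds[OF that(1)] by (auto simp: hi_def)
    qed
    have lo: "lo \<le> \<sigma> x" if "x \<in> {1..n}" "c < x" for x
    proof -
      have "real c \<le> real (\<sigma> x) + K"
        by (rule left_displacement_le[OF t K that])
      then have "c - \<sigma> x \<le> w"
        using tK by (intro w) (cases "c \<le> \<sigma> x"; simp add: of_nat_diff)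
      then show ?thesis using bounds[OF that(1)] by (auto simp: lo_def)
    qed
    let ?E = "{(a, b). a \<in> {1..n} \<and> b \<in> {1..n} \<and> a \<le> c \<and> c < b \<and> \<sigma> b < \<sigma> a}"
    \<comment> \<open>Listing the window by position makes list order agree with
      \<open>\<sigma>\<close>, so \<open>cut_inversions\<close> recovers every inversion straddling
      \<open>c\<close>.\<close>
    define xs where "xs = map (inv \<sigma>) [lo..<Suc hi]"
    have inv: "inv \<sigma> (\<sigma> x) = x" "\<sigma> (inv \<sigma> x) = x" for x
      using permutes_inverses[OF perm] by auto
    have inv_mem: "inv \<sigma> x \<in> {1..n}" if "x \<in> {1..n}" for x
      using permutes_in_image[OF permutes_inv[OF perm], of x] that by blast
    have nth: "xs ! k = inv \<sigma> (lo + k)" if "k < length xs" for k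
      using that unfolding xs_def by (simp del: upt_Suc)
    have len: "length xs = Suc hi - lo"
      by (simp add: xs_def del: upt_Suc)
    have mem: "xs ! k \<in> {1..n}" if "k < length xs" for k
      unfolding nth[OF that] using that by (intro inv_mem) (auto simp: len lo_def hi_def)
    have E_eq: "cut_inversions xs c = ?E"
    proof (intro set_eqI iffI)
      fix z assume "z \<in> cut_inversions xs c"
      then obtain k l where z: "fst z \<le> c" "c < snd z" "k < length xs" "l < k"
          "snd z = xs ! l" "fst z = xs ! k"
        by (auto simp: cut_inversions_def)
      moreover have "\<sigma> (xs ! l) < \<sigma> (xs ! k)"
        using nth[of k] nth[of l] z by (simp add: inv)
      ultimately show "z \<in> ?E"
        using mem[of k] mem[of l] by (auto simp: case_prod_beta)
    next
      fix z assume "z \<in> ?E"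
      then obtain a b where z: "z = (a, b)" and a: "a \<in> {1..n}" "a \<le> c"
          and b: "b \<in> {1..n}" "c < b" and ab: "\<sigma> b < \<sigma> a" by auto
      note win = crossing_inversions_in_window[OF a b ab hi lo]
      have k: "\<sigma> a - lo < length xs" "\<sigma> b - lo < \<sigma> a - lo"
        using win ab by (auto simp: len)
      then have "xs ! (\<sigma> a - lo) = a" "xs ! (\<sigma> b - lo) = b"
        using win by (simp_all add: nth inv)
      then show "z \<in> cut_inversions xs c"
        unfolding z cut_inversions_def using a b k by blast
    qed
    let ?U = "{x \<in> {1..n}. x \<le> c \<and> c < \<sigma> x}" and ?D = "{x \<in> {1..n}. c < x \<and> \<sigma> x \<le> c}"
    \<comment> \<open>Every item carried up over the cut is inverted with every item carried down
      over it.\<close>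
    have "card (?U \<times> ?D) = t * t"
      using c crossings_eq_downward[OF perm c(1)] by (simp add: card_cartesian_product crossings_def)
    moreover have "card (?U \<times> ?D) \<le> card ?E"
    proof (rule card_mono)
      show "finite ?E"
        by (rule finite_subset[of _ "{1..n} \<times> {1..n}"]) auto
      show "?U \<times> ?D \<subseteq> ?E"
        by auto
    qed
    ultimately have tE: "t * t \<le> card (cut_inversions xs c)"
      by (simp add: E_eq)
    have "length xs \<le> 2 * w + 2"
      by (auto simp: len lo_def hi_def)
    then have "real (length xs) \<le> 2 * K + 2"
      using wK by linarith
    \<comment> \<open>\<open>2 * K\<close> supplies 8 of the 10; the constant 2 is at most
      \<open>2 * t / \<gamma>\<close>.\<close>
    also have "\<dots> \<le> 10 * real t / \<gamma>"
    proof -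
      have "1 \<le> real t / \<gamma>"
        using t1 \<gamma> by (simp add: field_simps)
      then show ?thesis by (simp add: K_def)
    qed
    finally have len_le: "real (length xs) \<le> 10 * real t / \<gamma>" .
    have "D * real (length xs) \<le> real t * real t"
    proof (cases "D \<le> 0")
      case True
      then have "D * real (length xs) \<le> 0"
        by (intro mult_nonpos_nonneg) auto
      then show ?thesis
        by (smt (verit) zero_le_square)
    next
      case False
      then have "D * real (length xs) \<le> D * (10 * real t / \<gamma>)"
        using len_le by (intro mult_left_mono) auto
      also have "\<dots> = (10 * D / \<gamma>) * real t" by simp
      also have "\<dots> \<le> real t * real t"
        using tD by (intro mult_right_mono) auto
      finally show ?thesis .
    qed
    also have "\<dots> \<le> real (card (cut_inversions xs c))"
      using tE by (simp flip: of_nat_mult)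
    finally have D: "D * real (length xs) \<le> real (card (cut_inversions xs c))" .
    have "cut_inversions xs c \<noteq> {}"
      using tE t1 by auto
    then have ne: "xs \<noteq> []"
      by (auto simp: cut_inversions_def)
    have "set xs \<subseteq> {1..n}"
      using mem by (auto simp: in_set_conv_nth)
    moreover have "length xs \<le> n"
      by (auto simp: len lo_def hi_def)
    ultimately have "0 < (\<Sum>(a, b) \<in> cut_inversions xs c. r b a)"
      using good_cut[OF _ ne _ c(1) D] by blast
    also have "\<dots> = (\<Sum>z \<in> ?E. - (case z of (a, b) \<Rightarrow> r a b))"
      unfolding E_eq by (intro sum.cong refl) (auto intro: anti)
    also have "\<dots> \<le> 0"
      using optimal_sort_across_cut[OF anti opt, of c] by (simp add: sum_negf)
    finally show False by simp
  qed
  moreover have "real (crossings n \<sigma> p) \<le> real t"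
    using t[OF p] by simp
  ultimately show ?thesis by linarith
qed

text \<open>The nearest targets that the two move arguments allow are \<open>i + 1\<close> and
  \<open>i - 1\<close>, which costs the summand 1; the rest is their reach under the bound on
  crossings.\<close>

lemma displacement_le:
  assumes i: "i \<in> {1..n}"
  shows "real_of_int \<bar>int (\<sigma> i) - int i\<bar> \<le> 1 + 4 * max L (10 * D / \<gamma>) / \<gamma>"
proof -
  define T where "T = max L (10 * D / \<gamma>)"
  define t where "t = nat \<lfloor>T\<rfloor>"
  have T: "0 < T" "L \<le> T" using L by (auto simp: T_def)
  have t: "crossings n \<sigma> p \<le> t" if "p \<le> n" for p
    unfolding t_def T_def using crossings_le[OF that] by (simp add: le_nat_floor)
  have "real t \<le> T"
    unfolding t_def using T by (simp add: of_nat_floor)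
  then have K: "4 * real t / \<gamma> \<le> 4 * T / \<gamma>"
    using \<gamma> by (intro divide_right_mono) auto
  have "T \<le> 4 * T / \<gamma>"
    using \<gamma> T mult_right_mono[of \<gamma> 4 T] by (simp add: field_simps)
  then have LK: "L \<le> 4 * T / \<gamma>" using T by linarith
  have "real (\<sigma> i) \<le> real (i + 1) + 4 * T / \<gamma>"
    by (rule right_displacement_le[OF t LK K i]) auto
  moreover have "real (i - 1) \<le> real (\<sigma> i) + 4 * T / \<gamma>"
    by (rule left_displacement_le[OF t LK K i]) (use i in auto)
  moreover have "real (i - 1) = real i - 1"
    using i by auto
  ultimately show ?thesis
    unfolding T_def[symmetric] by simp
qed

end

subsection \<open>Concentration\<close>

context noisy_sorting
begin

section \<open>Means of outcomes and relabelling by true rank\<close>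

lemma measurable_outcome:
  assumes "i \<in> {1..n}" "j \<in> {1..n}" "i \<noteq> j"
  shows "(\<lambda>\<omega>. q \<omega> i j) \<in> measurable M (count_space UNIV)"
proof -
  have less: "(\<lambda>\<omega>. q \<omega> i j) \<in> measurable M (count_space UNIV)"
    if "i \<in> {1..n}" "j \<in> {1..n}" "i < j" for i j
    using indep that by (auto simp: indep_vars_def)
  show ?thesis
  proof (cases "i < j")
    case True
    then show ?thesis using less assms by blast
  next
    case False
    then have [measurable]: "(\<lambda>\<omega>. q \<omega> j i) \<in> measurable M (count_space UNIV)"
      using less assms by simp
    have "(\<lambda>\<omega>. - q \<omega> j i) \<in> measurable M (count_space UNIV)"
      by measurable
    moreover have "q \<omega> i j = - q \<omega> j i" if "\<omega> \<in> space M" for \<omega>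
      using antisym[OF that] assms by blast
    ultimately show ?thesis
      by (subst measurable_cong[where g = "\<lambda>\<omega>. - q \<omega> j i"]) auto
  qed
qed

text \<open>An outcome is twice the indicator of \<open>+1\<close>, minus 1, so an advantage
  \<open>\<gamma>\<close> over one half becomes a mean of \<open>2 * \<gamma>\<close>.\<close>

lemma expectation_outcome_ge:
  assumes ij: "i \<in> {1..n}" "j \<in> {1..n}" "\<pi> j < \<pi> i"
  shows "2 * \<gamma> \<le> expectation (\<lambda>\<omega>. real_of_int (q \<omega> i j))"
proof -
  have ne: "i \<noteq> j" using ij by auto
  note [measurable] = measurable_outcome[OF ij(1,2) ne]
  let ?A = "{\<omega> \<in> space M. q \<omega> i j = 1}"
  have A: "?A \<in> events" by measurable
  have "expectation (\<lambda>\<omega>. real_of_int (q \<omega> i j)) = expectation (\<lambda>\<omega>. 2 * indicator ?A \<omega> - 1)"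
  proof (rule Bochner_Integration.integral_cong)
    fix \<omega> assume "\<omega> \<in> space M"
    then show "real_of_int (q \<omega> i j) = 2 * indicator ?A \<omega> - 1"
      using outcome[of \<omega> i j] ij ne by (auto simp: indicator_def)
  qed simp
  also have "\<dots> = 2 * prob ?A - 1"
    using A by (subst Bochner_Integration.integral_diff) (auto simp: prob_space emeasure_eq_measure)
  finally show ?thesis
    using bias[OF ij] by simp
qed

text \<open>Indexing by true rank makes \<open>relabelled \<omega> b a = 1\<close> the correct
  outcome for \<open>a < b\<close>.\<close>

definition relabelled :: "'a \<Rightarrow> nat \<Rightarrow> nat \<Rightarrow> int" where
  "relabelled \<omega> a b = q \<omega> (inv \<pi> a) (inv \<pi> b)"

lemma inv_true_order:
  assumes "a \<in> {1..n}"
  shows "inv \<pi> a \<in> {1..n}"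
  using permutes_in_image[OF permutes_inv[OF true_order], of a] assms by blast

lemma inv_true_order_eq_iff: "inv \<pi> a = inv \<pi> b \<longleftrightarrow> a = b"
  by (rule inj_eq[OF permutes_inj[OF permutes_inv[OF true_order]]])

lemma relabelled_values:
  assumes "\<omega> \<in> space M" "a \<in> {1..n}" "b \<in> {1..n}" "a \<noteq> b"
  shows "relabelled \<omega> a b \<in> {1, -1}"
  unfolding relabelled_def using assms
  by (intro outcome inv_true_order) (auto simp: inv_true_order_eq_iff)

lemma relabelled_antisym:
  assumes "\<omega> \<in> space M" "a \<in> {1..n}" "b \<in> {1..n}" "a \<noteq> b"
  shows "relabelled \<omega> b a = - relabelled \<omega> a b"
  unfolding relabelled_def using assms
  by (intro antisym inv_true_order) (auto simp: inv_true_order_eq_iff)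

text \<open>A pair with \<open>a < b\<close> counts 1 if compared correctly and -1 otherwise. Its
  mean is at least \<open>2 * \<gamma>\<close>; the threshold asks for half of that.\<close>

definition mostly_correct :: "'a \<Rightarrow> (nat \<times> nat) set \<Rightarrow> bool" where
  "mostly_correct \<omega> E \<longleftrightarrow> \<gamma> * real (card E) < real_of_int (\<Sum>(a, b) \<in> E. relabelled \<omega> b a)"

section \<open>Tail bounds for sets of pairs\<close>

lemma sets_mostly_correct:
  assumes E: "E \<subseteq> {(a, b). a \<in> {1..n} \<and> b \<in> {1..n} \<and> a < b}"
  shows "{\<omega> \<in> space M. \<not> mostly_correct \<omega> E} \<in> events"
proof -
  have "(\<lambda>\<omega>. real_of_int (relabelled \<omega> (snd z) (fst z))) \<in> borel_measurable M" if "z \<in> E" for z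
  proof -
    have "(\<lambda>\<omega>. relabelled \<omega> (snd z) (fst z)) \<in> measurable M (count_space UNIV)"
      unfolding relabelled_def using that E
      by (intro measurable_outcome inv_true_order) (auto simp: inv_true_order_eq_iff)
    then show ?thesis by measurable
  qed
  then have [measurable]: "(\<lambda>\<omega>. \<Sum>z \<in> E. real_of_int (relabelled \<omega> (snd z) (fst z))) \<in> borel_measurable M"
    by (rule borel_measurable_sum)
  show ?thesis
    unfolding mostly_correct_def case_prod_beta of_int_sum by measurable
qed

text \<open>Hoeffding for \<open>k\<close> independent variables in \<open>[-1, 1]\<close>: the
  total mean is at least \<open>2 * \<gamma> * k\<close>, so missing the threshold is a deviation of
  at least \<open>\<gamma> * k\<close>, and the squared ranges add up to
  \<open>4 * k\<close>.\<close>

lemma prob_not_mostly_correct: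
  assumes E: "E \<subseteq> {(a, b). a \<in> {1..n} \<and> b \<in> {1..n} \<and> a < b}" and \<gamma>: "0 < \<gamma>"
  shows "prob {\<omega> \<in> space M. \<not> mostly_correct \<omega> E} \<le> exp (- (\<gamma>\<^sup>2 * real (card E) / 2))"
proof (cases "E = {}")
  \<comment> \<open>The strict inequality fails for the empty set, where the claimed bound is
    1.\<close>
  case True
  then show ?thesis by simp
next
  case False
  define key where "key z = (min (inv \<pi> (fst z)) (inv \<pi> (snd z)), max (inv \<pi> (fst z)) (inv \<pi> (snd z)))"
    for z :: "nat \<times> nat"
  \<comment> \<open>The sign makes a correct outcome count as +1 whichever item of the increasing
    index pair is truly higher.\<close>
  define sgn_of where "sgn_of z x = (if \<pi> (fst z) < \<pi> (snd z) then - real_of_int x else real_of_int x)"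
    for z :: "nat \<times> nat" and x :: int
  \<comment> \<open>\<open>V (key z)\<close> reads the outcome of the rank pair \<open>z\<close> off the increasing pair of item indices,
    for which independence is assumed.\<close>
  define V where "V z \<omega> = sgn_of z (q \<omega> (fst z) (snd z))" for z \<omega>
  let ?I = "key ` E"
  have fin: "finite E"
    by (rule finite_subset[OF E], rule finite_subset[of _ "{1..n} \<times> {1..n}"]) auto
  have inv: "\<pi> (inv \<pi> x) = x" for x
    using permutes_inverses[OF true_order] by auto
  have key_in: "fst (key z) \<in> {1..n}" "snd (key z) \<in> {1..n}" "fst (key z) < snd (key z)" if "z \<in> E" for z
  proof -
    have z: "fst z \<in> {1..n}" "snd z \<in> {1..n}" "fst z \<noteq> snd z" using that E by auto
    show "fst (key z) \<in> {1..n}" "snd (key z) \<in> {1..n}"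
      using inv_true_order[OF z(1)] inv_true_order[OF z(2)] by (auto simp: key_def min_def max_def)
    show "fst (key z) < snd (key z)"
      using z(3) inv_true_order_eq_iff[of "fst z" "snd z"] by (auto simp: key_def min_def max_def)
  qed
  \<comment> \<open>Distinct increasing rank pairs give distinct unordered item pairs, so no
    variable is used twice.\<close>
  have inj: "inj_on key E"
  proof (rule inj_onI)
    fix z z' assume z: "z \<in> E" "z' \<in> E" and "key z = key z'"
    then have "{inv \<pi> (fst z), inv \<pi> (snd z)} = {inv \<pi> (fst z'), inv \<pi> (snd z')}"
      by (auto simp: key_def min_def max_def split: if_splits)
    then have "{fst z, snd z} = {fst z', snd z'}"
      using inv_true_order_eq_iff by (simp add: doubleton_eq_iff)
    moreover have "fst z < snd z" "fst z' < snd z'" using z E by auto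
    ultimately show "z = z'"
      by (auto simp: doubleton_eq_iff prod_eq_iff)
  qed
  have V_key: "V (key z) \<omega> = real_of_int (relabelled \<omega> (snd z) (fst z))" if "z \<in> E" "\<omega> \<in> space M" for z \<omega>
  proof -
    have z: "fst z \<in> {1..n}" "snd z \<in> {1..n}" "fst z < snd z" using that E by auto
    have "relabelled \<omega> (snd z) (fst z) = - relabelled \<omega> (fst z) (snd z)"
      using relabelled_antisym[OF that(2) z(1,2)] z(3) by simp
    then show ?thesis
      using z(3) by (auto simp: V_def sgn_of_def key_def min_def max_def inv relabelled_def)
  qed
  have card_I: "card ?I = card E"
    using inj by (rule card_image)
  have "indep_vars (\<lambda>_. borel) (\<lambda>z \<omega>. sgn_of z ((\<lambda>(i, j) \<omega>. q \<omega> i j) z \<omega>)) ?I"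
  proof (rule indep_vars_compose2[OF indep_vars_subset[OF indep]])
    show "?I \<subseteq> {(i, j). i \<in> {1..n} \<and> j \<in> {1..n} \<and> i < j}"
    proof (rule image_subsetI)
      fix z assume "z \<in> E"
      then show "key z \<in> {(i, j). i \<in> {1..n} \<and> j \<in> {1..n} \<and> i < j}"
        using key_in[of z] by (simp add: case_prod_beta)
    qed
  qed simp
  then have ind: "indep_vars (\<lambda>_. borel) V ?I"
    by (simp add: V_def[abs_def] case_prod_beta)
  have V_range: "V z \<omega> \<in> {-1..1}" if "z \<in> ?I" "\<omega> \<in> space M" for z \<omega>
  proof -
    from that(1) obtain z' where "z' \<in> E" "z = key z'" by blast
    then have "fst z \<in> {1..n}" "snd z \<in> {1..n}" "fst z \<noteq> snd z"
      using key_in[of z'] by simp_all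
    then have "q \<omega> (fst z) (snd z) \<in> {1, -1}"
      by (rule outcome[OF that(2)])
    then show ?thesis by (auto simp: V_def sgn_of_def)
  qed
  interpret H: Hoeffding_ineq M ?I V "\<lambda>_. -1" "\<lambda>_. 1" "\<Sum>z\<in>?I. expectation (V z)"
  proof unfold_locales
    show "finite ?I" using fin by simp
    show "indep_vars (\<lambda>_. borel) V ?I" by (rule ind)
    show "AE x in M. V i x \<in> {-1..1}" if "i \<in> ?I" for i
      using V_range[OF that] by (intro AE_I2) blast
  qed simp_all
  have ge: "2 * \<gamma> \<le> expectation (V (key z))" if "z \<in> E" for z
  proof -
    have z: "fst z \<in> {1..n}" "snd z \<in> {1..n}" "fst z < snd z" using that E by auto
    have "2 * \<gamma> \<le> expectation (\<lambda>\<omega>. real_of_int (q \<omega> (inv \<pi> (snd z)) (inv \<pi> (fst z))))"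
      using z by (intro expectation_outcome_ge inv_true_order) (auto simp: inv)
    also have "\<dots> = expectation (V (key z))"
      using V_key[OF that] by (intro Bochner_Integration.integral_cong) (auto simp: relabelled_def)
    finally show ?thesis .
  qed
  let ?k = "real (card E)"
  let ?\<mu> = "\<Sum>z\<in>?I. expectation (V z)"
  \<comment> \<open>The exact gap between the total mean and the threshold; the individual means are
    only bounded below.\<close>
  define \<epsilon> where "\<epsilon> = ?\<mu> - \<gamma> * ?k"
  have k: "0 < ?k"
    using False fin by (simp add: card_gt_0_iff)
  have "?\<mu> = (\<Sum>z\<in>E. expectation (V (key z)))"
    using inj by (simp add: sum.reindex)
  also have "\<dots> \<ge> (\<Sum>z\<in>E. 2 * \<gamma>)"
    by (intro sum_mono ge)
  finally have \<epsilon>: "\<gamma> * ?k \<le> \<epsilon>" by (simp add: \<epsilon>_def algebra_simps)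
  have \<epsilon>0: "0 \<le> \<gamma> * ?k" using \<gamma> by simp
  have "{\<omega> \<in> space M. \<not> mostly_correct \<omega> E} = {\<omega> \<in> space M. (\<Sum>z\<in>?I. V z \<omega>) \<le> ?\<mu> - \<epsilon>}"
  proof (rule Collect_cong, rule conj_cong[OF refl])
    fix \<omega> assume \<omega>: "\<omega> \<in> space M"
    have "(\<Sum>z\<in>?I. V z \<omega>) = (\<Sum>z\<in>E. V (key z) \<omega>)"
      using inj by (simp add: sum.reindex)
    also have "\<dots> = (\<Sum>z\<in>E. real_of_int (relabelled \<omega> (snd z) (fst z)))"
      by (intro sum.cong refl V_key \<omega>)
    finally show "(\<not> mostly_correct \<omega> E) = ((\<Sum>z\<in>?I. V z \<omega>) \<le> ?\<mu> - \<epsilon>)"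
      by (simp add: mostly_correct_def \<epsilon>_def case_prod_beta not_less)
  qed
  also have "prob \<dots> \<le> exp (- 2 * \<epsilon>\<^sup>2 / (\<Sum>z\<in>?I. (1 - (- 1))\<^sup>2))"
    by (rule H.Hoeffding_ineq_le) (use \<epsilon> \<epsilon>0 k card_I in auto)
  also have "\<dots> = exp (- (\<epsilon>\<^sup>2 / (2 * ?k)))"
    by (simp add: card_I)
  also have "\<dots> \<le> exp (- ((\<gamma> * ?k)\<^sup>2 / (2 * ?k)))"
    using \<epsilon> \<epsilon>0 k by (simp add: divide_right_mono power_mono)
  also have "(\<gamma> * ?k)\<^sup>2 / (2 * ?k) = \<gamma>\<^sup>2 * ?k / 2"
    using k by (simp add: power2_eq_square)
  finally show ?thesis .
qed

lemma prob_ex_not_mostly_correct: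
  assumes J: "finite J" and E: "\<forall>j\<in>J. E j \<subseteq> {(a, b). a \<in> {1..n} \<and> b \<in> {1..n} \<and> a < b}"
    and \<gamma>: "0 < \<gamma>"
  shows "{\<omega> \<in> space M. \<exists>j \<in> J. \<not> mostly_correct \<omega> (E j)} \<in> events" (is "?B \<in> _")
    and "prob {\<omega> \<in> space M. \<exists>j \<in> J. \<not> mostly_correct \<omega> (E j)}
      \<le> (\<Sum>j\<in>J. exp (- (\<gamma>\<^sup>2 * real (card (E j)) / 2)))"
proof -
  let ?B' = "\<lambda>j. {\<omega> \<in> space M. \<not> mostly_correct \<omega> (E j)}"
  have eq: "?B = (\<Union>j\<in>J. ?B' j)" by auto
  have meas: "?B' j \<in> events" if "j \<in> J" for j
    using E that by (intro sets_mostly_correct) blast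
  show "?B \<in> events"
    unfolding eq using meas J by blast
  have "prob ?B \<le> (\<Sum>j\<in>J. prob (?B' j))"
    unfolding eq using meas J by (intro finite_measure_subadditive_finite) auto
  also have "\<dots> \<le> (\<Sum>j\<in>J. exp (- (\<gamma>\<^sup>2 * real (card (E j)) / 2)))"
    using E by (intro sum_mono prob_not_mostly_correct \<gamma>) blast
  finally show "prob ?B \<le> (\<Sum>j\<in>J. exp (- (\<gamma>\<^sup>2 * real (card (E j)) / 2)))" .
qed

text \<open>Composition with \<open>\<pi>\<close> is a bijection on rankings that carries the
  relabelled score to the original one, so maximisers correspond.\<close>

lemma optimal_relabelled:
  assumes "optimal_ranking n (q \<omega>) \<sigma>"
  shows "optimal_ranking n (relabelled \<omega>) (\<sigma> \<circ> inv \<pi>)"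
proof -
  have \<sigma>: "\<sigma> permutes {1..n}" and opt: "\<And>\<tau>. \<tau> permutes {1..n} \<Longrightarrow> score n (q \<omega>) \<tau> \<le> score n (q \<omega>) \<sigma>"
    using assms by (auto simp: optimal_ranking_def)
  have inv: "\<pi> (inv \<pi> x) = x" "inv \<pi> (\<pi> x) = x" for x
    using permutes_inverses[OF true_order] by auto
  have \<pi>_mem: "\<pi> x \<in> {1..n}" if "x \<in> {1..n}" for x
    using permutes_in_image[OF true_order, of x] that by blast
  have score: "score n (relabelled \<omega>) \<tau> = score n (q \<omega>) (\<tau> \<circ> \<pi>)" for \<tau>
    unfolding score_def
  proof (rule sum.reindex_bij_witness[of _ "map_prod \<pi> \<pi>" "map_prod (inv \<pi>) (inv \<pi>)"])
    fix z assume z: "z \<in> {(i, j). i \<in> {1..n} \<and> j \<in> {1..n} \<and> \<tau> j < \<tau> i}"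
    then show "map_prod (inv \<pi>) (inv \<pi>) z \<in> {(i, j). i \<in> {1..n} \<and> j \<in> {1..n} \<and> (\<tau> \<circ> \<pi>) j < (\<tau> \<circ> \<pi>) i}"
      using inv_true_order[of "fst z"] inv_true_order[of "snd z"] by (auto simp: inv)
  next
    fix z assume z: "z \<in> {(i, j). i \<in> {1..n} \<and> j \<in> {1..n} \<and> (\<tau> \<circ> \<pi>) j < (\<tau> \<circ> \<pi>) i}"
    then show "map_prod \<pi> \<pi> z \<in> {(i, j). i \<in> {1..n} \<and> j \<in> {1..n} \<and> \<tau> j < \<tau> i}"
      using \<pi>_mem[of "fst z"] \<pi>_mem[of "snd z"] by auto
  qed (auto simp: inv relabelled_def)
  have "\<sigma> \<circ> inv \<pi> permutes {1..n}"
    by (rule permutes_compose[OF permutes_inv[OF true_order] \<sigma>])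
  moreover have "score n (relabelled \<omega>) \<tau> \<le> score n (relabelled \<omega>) (\<sigma> \<circ> inv \<pi>)"
    if "\<tau> permutes {1..n}" for \<tau>
  proof -
    have "\<sigma> \<circ> inv \<pi> \<circ> \<pi> = \<sigma>" by (auto simp: inv)
    then show ?thesis
      unfolding score using opt[OF permutes_compose[OF true_order that]] by simp
  qed
  ultimately show ?thesis
    by (simp add: optimal_ranking_def)
qed

text \<open>There are finitely many rankings, and each score is a finite sum of measurable integers,
  so the quantifiers range over a finite set.\<close>

lemma sets_optimal_event:
  "{\<omega> \<in> space M. \<forall>\<sigma>. optimal_ranking n (q \<omega>) \<sigma> \<longrightarrow> P \<sigma>} \<in> events"
proof -
  let ?S = "{\<sigma>. \<sigma> permutes {1..n}}"
  have fin: "finite ?S"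
    by (rule finite_permutations) simp
  have [measurable]: "(\<lambda>\<omega>. score n (q \<omega>) \<sigma>) \<in> measurable M (count_space UNIV)" for \<sigma>
  proof -
    let ?A = "{(i, j). i \<in> {1..n} \<and> j \<in> {1..n} \<and> \<sigma> j < \<sigma> i}"
    have "(\<lambda>\<omega>. \<Sum>z\<in>?A. q \<omega> (fst z) (snd z)) \<in> measurable M (count_space UNIV)"
    proof -
      have m: "(\<lambda>\<omega>. q \<omega> (fst z) (snd z)) \<in> measurable M (count_space UNIV)" if "z \<in> ?A" for z
        using that by (intro measurable_outcome) auto
      have "finite B \<Longrightarrow> B \<subseteq> ?A \<Longrightarrow> (\<lambda>\<omega>. \<Sum>z\<in>B. q \<omega> (fst z) (snd z)) \<in> measurable M (count_space UNIV)" for B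
      proof (induction rule: finite_induct)
        case (insert z B)
        then have [measurable]: "(\<lambda>\<omega>. q \<omega> (fst z) (snd z)) \<in> measurable M (count_space UNIV)"
            "(\<lambda>\<omega>. \<Sum>z\<in>B. q \<omega> (fst z) (snd z)) \<in> measurable M (count_space UNIV)"
          using m by auto
        show ?case using insert.hyps by simp
      qed simp
      moreover have "finite ?A"
        by (rule finite_subset[of _ "{1..n} \<times> {1..n}"]) auto
      ultimately show ?thesis by blast
    qed
    then show ?thesis
      by (simp add: score_def case_prod_beta)
  qed
  have "{\<omega> \<in> space M. \<forall>\<sigma>. optimal_ranking n (q \<omega>) \<sigma> \<longrightarrow> P \<sigma>}
      = {\<omega> \<in> space M. \<forall>\<sigma>\<in>?S. (\<forall>\<tau>\<in>?S. score n (q \<omega>) \<tau> \<le> score n (q \<omega>) \<sigma>) \<longrightarrow> P \<sigma>}"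
    by (auto simp: optimal_ranking_def)
  also have "\<dots> \<in> events"
    using fin by (intro sets.sets_Collect_finite_All sets.sets_Collect_imp) auto
  finally show ?thesis .
qed

end

subsection \<open>Union bounds\<close>

text \<open>Two geometric series, one on each side of \<open>i\<close>.\<close>

lemma sum_power_distance_le:
  fixes x :: real
  assumes x: "0 \<le> x" "x < 1"
  shows "(\<Sum>j = 1..n. x ^ nat \<bar>int j - int i\<bar>) \<le> 2 / (1 - x)"
proof -
  have geo: "(\<Sum>k\<in>K. x ^ k) \<le> 1 / (1 - x)" if "finite K" for K :: "nat set"
  proof -
    have "(\<Sum>k\<in>K. x ^ k) \<le> (\<Sum>k. x ^ k)"
      using x that by (intro sum_le_suminf summable_geometric) auto
    then show ?thesis
      using x by (simp add: suminf_geometric)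
  qed
  let ?A = "{j \<in> {1..n}. j \<le> i}" and ?B = "{j \<in> {1..n}. i < j}"
  have "(\<Sum>j = 1..n. x ^ nat \<bar>int j - int i\<bar>)
      = (\<Sum>j \<in> ?A \<union> ?B. x ^ nat \<bar>int j - int i\<bar>)"
    by (intro sum.cong) auto
  also have "\<dots> = (\<Sum>j \<in> ?A. x ^ nat \<bar>int j - int i\<bar>) + (\<Sum>j \<in> ?B. x ^ nat \<bar>int j - int i\<bar>)"
    by (intro sum.union_disjoint) auto
  also have "(\<Sum>j \<in> ?A. x ^ nat \<bar>int j - int i\<bar>) = (\<Sum>j \<in> ?A. x ^ (i - j))"
    by (intro sum.cong refl arg_cong[of _ _ "power x"]) auto
  also have "\<dots> = (\<Sum>k \<in> (\<lambda>j. i - j) ` ?A. x ^ k)"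
    by (subst sum.reindex) (auto simp: inj_on_def)
  also have "(\<Sum>j \<in> ?B. x ^ nat \<bar>int j - int i\<bar>) = (\<Sum>j \<in> ?B. x ^ (j - i))"
    by (intro sum.cong refl arg_cong[of _ _ "power x"]) auto
  also have "\<dots> = (\<Sum>k \<in> (\<lambda>j. j - i) ` ?B. x ^ k)"
    by (subst sum.reindex) (auto simp: inj_on_def)
  finally show ?thesis
    using geo[of "(\<lambda>j. i - j) ` ?A"] geo[of "(\<lambda>j. j - i) ` ?B"] by simp
qed

text \<open>The weight is a product over positions. Enlarging the sum from permutations to all
  functions lets it factor into single-position sums.\<close>

lemma sum_permutations_power_footrule_le:
  fixes x :: real
  assumes x: "0 \<le> x" "x < 1"
  shows "(\<Sum>\<sigma> | \<sigma> permutes {1..n}. x ^ nat (\<Sum>i = 1..n. \<bar>int (\<sigma> i) - int i\<bar>)) \<le> (2 / (1 - x)) ^ n"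
proof -
  let ?S = "{\<sigma>. \<sigma> permutes {1..n}}"
  let ?F = "\<lambda>f. \<Prod>i\<in>{1..n}. x ^ nat \<bar>int (f i) - int i\<bar>"
  \<comment> \<open>Restriction places permutations inside \<open>PiE\<close> and loses nothing, as
    they are the identity outside \<open>{1..n}\<close>.\<close>
  have inj: "inj_on (\<lambda>\<sigma>. restrict \<sigma> {1..n}) ?S"
  proof (rule inj_onI)
    fix \<sigma> \<tau> assume \<sigma>: "\<sigma> \<in> ?S" and \<tau>: "\<tau> \<in> ?S" and eq: "restrict \<sigma> {1..n} = restrict \<tau> {1..n}"
    show "\<sigma> = \<tau>"
    proof
      fix y show "\<sigma> y = \<tau> y"
      proof (cases "y \<in> {1..n}")
        case True
        then show ?thesis using fun_cong[OF eq, of y] by (simp only: restrict_apply')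
      next
        case False
        then show ?thesis
          using permutes_not_in[of \<sigma> "{1..n}" y] permutes_not_in[of \<tau> "{1..n}" y] \<sigma> \<tau> by simp
      qed
    qed
  qed
  have "x ^ nat (\<Sum>i = 1..n. \<bar>int (\<sigma> i) - int i\<bar>) = ?F (restrict \<sigma> {1..n})" for \<sigma> :: "nat \<Rightarrow> nat"
  proof -
    have "(\<Sum>i = 1..n. \<bar>int (\<sigma> i) - int i\<bar>) = int (\<Sum>i = 1..n. nat \<bar>int (\<sigma> i) - int i\<bar>)"
      by simp
    then have "nat (\<Sum>i = 1..n. \<bar>int (\<sigma> i) - int i\<bar>) = (\<Sum>i = 1..n. nat \<bar>int (\<sigma> i) - int i\<bar>)"
      by (simp only: nat_int)
    then show ?thesis by (simp add: power_sum)
  qed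
  then have "(\<Sum>\<sigma>\<in>?S. x ^ nat (\<Sum>i = 1..n. \<bar>int (\<sigma> i) - int i\<bar>)) = (\<Sum>f \<in> (\<lambda>\<sigma>. restrict \<sigma> {1..n}) ` ?S. ?F f)"
    using inj by (simp add: sum.reindex)
  also have "\<dots> \<le> (\<Sum>f \<in> PiE {1..n} (\<lambda>_. {1..n}). ?F f)"
  proof (rule sum_mono2)
    show "(\<lambda>\<sigma>. restrict \<sigma> {1..n}) ` ?S \<subseteq> PiE {1..n} (\<lambda>_. {1..n})"
      using permutes_atLeastAtMost_bounds by (force simp: PiE_iff)
  qed (use x in \<open>auto intro!: finite_PiE prod_nonneg\<close>)
  also have "\<dots> = (\<Prod>i\<in>{1..n}. \<Sum>j\<in>{1..n}. x ^ nat \<bar>int j - int i\<bar>)"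
    by (rule prod_sum_PiE[symmetric]) auto
  also have "\<dots> \<le> (\<Prod>i\<in>{1..n}. 2 / (1 - x))"
    using x by (intro prod_mono conjI sum_nonneg sum_power_distance_le) auto
  finally show ?thesis by simp
qed

text \<open>For \<open>c = \<gamma>\<^sup>2 / 8\<close> the exponent is at least
  \<open>2 * c\<close> times the footrule. One half pays for the footrule exceeding
  \<open>C * n\<close>, the other remains as the weight \<open>x ^ nat (F \<sigma>)\<close>. The
  choice of \<open>C\<close> makes \<open>c * C = ln S + \<beta>\<close>, which beats the sum
  \<open>S ^ n\<close>.\<close>

lemma sum_far_permutations_le:
  assumes \<gamma>: "0 < (\<gamma> :: real)" and n: "1 \<le> n"
    and C: "C = 8 * (ln (2 / (1 - exp (- (\<gamma>\<^sup>2 / 8)))) + \<beta>) / \<gamma>\<^sup>2" and \<beta>: "0 < \<beta>"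
  shows "(\<Sum>\<sigma> | \<sigma> permutes {1..n} \<and> C * real n < real_of_int (\<Sum>i = 1..n. \<bar>int (\<sigma> i) - int i\<bar>).
      exp (- (\<gamma>\<^sup>2 * real (card {(a, b). a \<in> {1..n} \<and> b \<in> {1..n} \<and> a < b \<and> \<sigma> b < \<sigma> a}) / 2)))
    \<le> real n powr - \<beta>"
proof -
  define c where "c = \<gamma>\<^sup>2 / 8"
  define x where "x = exp (- c)"
  define S where "S = 2 / (1 - x)"
  define F where "F \<sigma> = (\<Sum>i = 1..n. \<bar>int (\<sigma> i) - int i\<bar>)" for \<sigma> :: "nat \<Rightarrow> nat"
  let ?I = "\<lambda>\<sigma>. {(a, b). a \<in> {1..n} \<and> b \<in> {1..n} \<and> a < b \<and> \<sigma> b < \<sigma> (a :: nat)}"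
  let ?J = "{\<sigma>. \<sigma> permutes {1..n} \<and> C * real n < real_of_int (F \<sigma>)}"
  have c: "0 < c" using \<gamma> by (simp add: c_def)
  have x: "0 \<le> x" "x < 1" using c by (auto simp: x_def)
  have S: "0 < S" using x by (simp add: S_def)
  have cC: "c * C = ln S + \<beta>"
    using \<gamma> by (simp add: C c_def S_def x_def)
  have Fpos: "0 \<le> F \<sigma>" for \<sigma> by (simp add: F_def sum_nonneg)
  have "exp (- (\<gamma>\<^sup>2 * real (card (?I \<sigma>)) / 2)) \<le> exp (- (c * C * real n)) * x ^ nat (F \<sigma>)"
    if \<sigma>: "\<sigma> \<in> ?J" for \<sigma>
  proof -
    have "F \<sigma> \<le> 2 * int (card (?I \<sigma>))"
      unfolding F_def using \<sigma> by (intro footrule_le_inversions) auto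
    then have "real_of_int (F \<sigma>) \<le> real_of_int (2 * int (card (?I \<sigma>)))"
      by (simp only: of_int_le_iff)
    then have "c * real_of_int (F \<sigma>) \<le> c * (2 * real (card (?I \<sigma>)))"
      using c by (intro mult_left_mono) auto
    moreover have "c * (C * real n) \<le> c * real_of_int (F \<sigma>)"
      using \<sigma> c by (intro mult_left_mono) auto
    ultimately have "- (\<gamma>\<^sup>2 * real (card (?I \<sigma>)) / 2) \<le> - (c * C * real n) + real (nat (F \<sigma>)) * - c"
      using Fpos[of \<sigma>] unfolding c_def by (simp add: algebra_simps)
    then have "exp (- (\<gamma>\<^sup>2 * real (card (?I \<sigma>)) / 2)) \<le> exp (- (c * C * real n) + real (nat (F \<sigma>)) * - c)"
      by (simp only: exp_le_cancel_iff)
    also have "\<dots> = exp (- (c * C * real n)) * x ^ nat (F \<sigma>)"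
      unfolding x_def exp_of_nat_mult[symmetric] exp_add by simp
    finally show ?thesis .
  qed
  then have "(\<Sum>\<sigma>\<in>?J. exp (- (\<gamma>\<^sup>2 * real (card (?I \<sigma>)) / 2)))
      \<le> (\<Sum>\<sigma>\<in>?J. exp (- (c * C * real n)) * x ^ nat (F \<sigma>))"
    by (intro sum_mono)
  also have "\<dots> \<le> (\<Sum>\<sigma> | \<sigma> permutes {1..n}. exp (- (c * C * real n)) * x ^ nat (F \<sigma>))"
    using x by (intro sum_mono2 finite_permutations) auto
  also have "\<dots> = exp (- (c * C * real n)) * (\<Sum>\<sigma> | \<sigma> permutes {1..n}. x ^ nat (F \<sigma>))"
    by (simp add: sum_distrib_left)
  also have "\<dots> \<le> exp (- (c * C * real n)) * S ^ n"
    unfolding F_def S_def by (intro mult_left_mono sum_permutations_power_footrule_le x) auto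
  also have "S ^ n = exp (real n * ln S)"
    using S by (simp add: exp_of_nat_mult)
  also have "exp (- (c * C * real n)) * exp (real n * ln S) = exp (- (\<beta> * real n))"
    unfolding cC exp_add[symmetric] by (simp add: algebra_simps)
  also have "\<dots> \<le> exp (- (\<beta> * ln (real n)))"
  proof -
    have "ln (real n) \<le> real n"
      using ln_le_minus_one[of "real n"] n by linarith
    then show ?thesis using \<beta> by simp
  qed
  also have "\<dots> = real n powr - \<beta>"
    using n by (simp add: powr_def)
  finally show ?thesis
    unfolding F_def .
qed

text \<open>For length \<open>m\<close> there are \<open>n ^ m * (n + 1)\<close> choices of list and
  cut, each of weight at most \<open>n powr (- (\<beta> + 3) * m)\<close>. As
  \<open>m \<ge> 1\<close>, one length costs at most \<open>2 * n powr (- \<beta> - 1)\<close>, and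
  there are \<open>n\<close> lengths.\<close>

lemma sum_cut_inversions_le:
  fixes \<gamma> \<beta> :: real
  assumes \<gamma>: "0 < \<gamma>" and n: "1 \<le> n" and \<beta>: "0 < \<beta>"
    and D: "D = 2 * (\<beta> + 3) / \<gamma>\<^sup>2 * ln (real n)"
  shows "(\<Sum>(m, xs, p) \<in> Sigma {1..n} (\<lambda>m. {(xs, p). set xs \<subseteq> {1..n} \<and> length xs = m \<and> p \<le> n \<and>
        D * real m \<le> real (card (cut_inversions xs p))}).
      exp (- (\<gamma>\<^sup>2 * real (card (cut_inversions xs p)) / 2))) \<le> 2 * real n powr - \<beta>"
proof -
  let ?B = "\<lambda>m. {xs. set xs \<subseteq> {1..n} \<and> length xs = m} \<times> {..n}"
  let ?A = "\<lambda>m. {(xs, p). set xs \<subseteq> {1..n} \<and> length xs = m \<and> p \<le> n \<and>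
      D * real m \<le> real (card (cut_inversions xs p))}"
  let ?N = "real n"
  have finB: "finite (?B m)" for m
    by (intro finite_cartesian_product finite_lists_length_eq) auto
  have sub: "?A m \<subseteq> ?B m" for m by auto
  have inner: "(\<Sum>(xs, p) \<in> ?A m. exp (- (\<gamma>\<^sup>2 * real (card (cut_inversions xs p)) / 2)))
      \<le> 2 * ?N powr (- \<beta> - 1)" if m: "m \<in> {1..n}" for m
  proof -
    have "exp (- (\<gamma>\<^sup>2 * real (card (cut_inversions xs p)) / 2)) \<le> ?N powr (- (\<beta> + 3) * real m)"
      if "(xs, p) \<in> ?A m" for xs p
    proof -
      have "\<gamma>\<^sup>2 * (D * real m) \<le> \<gamma>\<^sup>2 * real (card (cut_inversions xs p))"
        using that by (intro mult_left_mono) auto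
      moreover have "\<gamma>\<^sup>2 * (D * real m) = 2 * (\<beta> + 3) * ln ?N * real m"
        using \<gamma> by (simp add: D)
      ultimately have "- (\<gamma>\<^sup>2 * real (card (cut_inversions xs p)) / 2) \<le> - (\<beta> + 3) * real m * ln ?N"
        by (simp add: algebra_simps)
      then show ?thesis
        using n by (simp add: powr_def)
    qed
    then have "(\<Sum>(xs, p) \<in> ?A m. exp (- (\<gamma>\<^sup>2 * real (card (cut_inversions xs p)) / 2)))
        \<le> (\<Sum>z \<in> ?A m. ?N powr (- (\<beta> + 3) * real m))"
      by (intro sum_mono) auto
    also have "\<dots> = real (card (?A m)) * ?N powr (- (\<beta> + 3) * real m)"
      by simp
    also have "\<dots> \<le> real (card (?B m)) * ?N powr (- (\<beta> + 3) * real m)"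
      using card_mono[OF finB sub] by (intro mult_right_mono) auto
    also have "card (?B m) = n ^ m * (n + 1)"
      by (simp add: card_cartesian_product card_lists_length_eq)
    also have "real (n ^ m * (n + 1)) * ?N powr (- (\<beta> + 3) * real m)
        \<le> (?N powr real m * (2 * ?N powr 1)) * ?N powr (- (\<beta> + 3) * real m)"
      using n by (intro mult_right_mono) (auto simp: powr_realpow)
    also have "\<dots> = 2 * ?N powr (real m + 1 + - (\<beta> + 3) * real m)"
      by (simp only: powr_add mult_ac)
    also have "real m + 1 + - (\<beta> + 3) * real m = 1 - (\<beta> + 2) * real m"
      by (simp add: algebra_simps)
    also have "2 * ?N powr (1 - (\<beta> + 2) * real m) \<le> 2 * ?N powr (- \<beta> - 1)"
    proof -
      have "(\<beta> + 2) * 1 \<le> (\<beta> + 2) * real m"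
        using m \<beta> by (intro mult_left_mono) auto
      then have "1 - (\<beta> + 2) * real m \<le> - \<beta> - 1" by simp
      then show ?thesis using n by (intro mult_left_mono powr_mono) auto
    qed
    finally show ?thesis .
  qed
  have "(\<Sum>(m, xs, p) \<in> Sigma {1..n} ?A. exp (- (\<gamma>\<^sup>2 * real (card (cut_inversions xs p)) / 2)))
      = (\<Sum>m = 1..n. \<Sum>(xs, p) \<in> ?A m. exp (- (\<gamma>\<^sup>2 * real (card (cut_inversions xs p)) / 2)))"
    using finite_subset[OF sub finB] by (subst sum.Sigma) auto
  also have "\<dots> \<le> (\<Sum>m = 1..n. 2 * ?N powr (- \<beta> - 1))"
    by (intro sum_mono inner)
  also have "\<dots> = 2 * (?N powr 1 * ?N powr (- \<beta> - 1))"
    using n by simp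
  also have "?N powr 1 * ?N powr (- \<beta> - 1) = ?N powr (1 + (- \<beta> - 1))"
    by (simp only: powr_add)
  also have "\<dots> = ?N powr - \<beta>"
    by simp
  finally show ?thesis .
qed

text \<open>At most \<open>n ^ 3\<close> triples, each of weight at most
  \<open>n powr (- \<beta> - 3)\<close>.\<close>

lemma sum_intervals_le:
  fixes \<gamma> \<beta> :: real
  assumes \<gamma>: "0 < \<gamma>" and n: "1 \<le> n"
    and L: "L = 2 * (\<beta> + 3) / \<gamma>\<^sup>2 * ln (real n)"
    and J: "J \<subseteq> {1..n} \<times> {1..n} \<times> {1..n}"
    and E: "\<And>j. j \<in> J \<Longrightarrow> L \<le> real (card (E j))"
  shows "(\<Sum>j\<in>J. exp (- (\<gamma>\<^sup>2 * real (card (E j)) / 2))) \<le> real n powr - \<beta>"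
proof -
  let ?N = "real n"
  have "exp (- (\<gamma>\<^sup>2 * real (card (E j)) / 2)) \<le> ?N powr (- \<beta> - 3)" if "j \<in> J" for j
  proof -
    have "\<gamma>\<^sup>2 * L \<le> \<gamma>\<^sup>2 * real (card (E j))"
      using E[OF that] by (intro mult_left_mono) auto
    moreover have "\<gamma>\<^sup>2 * L = 2 * (\<beta> + 3) * ln ?N"
      using \<gamma> by (simp add: L)
    ultimately have "- (\<gamma>\<^sup>2 * real (card (E j)) / 2) \<le> (- \<beta> - 3) * ln ?N"
      by (simp add: algebra_simps)
    then show ?thesis
      using n by (simp add: powr_def)
  qed
  then have "(\<Sum>j\<in>J. exp (- (\<gamma>\<^sup>2 * real (card (E j)) / 2))) \<le> (\<Sum>j\<in>J. ?N powr (- \<beta> - 3))"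
    by (rule sum_mono)
  also have "\<dots> = real (card J) * ?N powr (- \<beta> - 3)"
    by simp
  also have "\<dots> \<le> ?N powr 3 * ?N powr (- \<beta> - 3)"
  proof (rule mult_right_mono)
    have "card J \<le> card ({1..n} \<times> {1..n} \<times> {1..n})"
      by (rule card_mono[OF _ J]) auto
    then have "card J \<le> n ^ 3"
      by (simp add: card_cartesian_product power3_eq_cube)
    then have "real (card J) \<le> real (n ^ 3)"
      by (simp only: of_nat_le_iff)
    then show "real (card J) \<le> ?N powr 3"
      using n powr_realpow[of ?N 3] by simp
  qed simp
  also have "\<dots> = ?N powr (3 + (- \<beta> - 3))"
    by (simp only: powr_add)
  also have "\<dots> = ?N powr - \<beta>"
    by simp
  finally show ?thesis .
qed

subsection \<open>Main result\<close>

context noisy_sorting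
begin

lemma mostly_correct_above:
  "mostly_correct \<omega> ({a} \<times> {s..e}) \<longleftrightarrow>
    \<gamma> * real (e + 1 - s) < real_of_int (\<Sum>x \<in> {s..e}. relabelled \<omega> x a)"
  by (simp add: mostly_correct_def card_cartesian_product sum.cartesian_product[symmetric])

lemma mostly_correct_below:
  "mostly_correct \<omega> ({s..e} \<times> {a}) \<longleftrightarrow>
    \<gamma> * real (e + 1 - s) < real_of_int (\<Sum>x \<in> {s..e}. relabelled \<omega> a x)"
  by (simp add: mostly_correct_def card_cartesian_product sum.cartesian_product[symmetric])

lemma mostly_correct_imp_pos:
  assumes "mostly_correct \<omega> E" "0 < \<gamma>"
  shows "0 < (\<Sum>(a, b) \<in> E. relabelled \<omega> b a)"
proof -
  have "0 \<le> \<gamma> * real (card E)" using assms(2) by simp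
  then have "0 < real_of_int (\<Sum>(a, b) \<in> E. relabelled \<omega> b a)"
    using assms(1) unfolding mostly_correct_def by linarith
  then show ?thesis by (simp only: of_int_0_less_iff)
qed

lemma prob_optimal_close:
  assumes \<gamma>: "0 < \<gamma>" "\<gamma> < 1 / 2" and \<beta>: "0 < \<beta>" and n: "2 \<le> n"
    and C1: "8 * (ln (2 / (1 - exp (- (\<gamma>\<^sup>2 / 8)))) + \<beta>) / \<gamma>\<^sup>2 \<le> C"
    and C2: "2 + 80 * (\<beta> + 3) / \<gamma> ^ 4 \<le> C"
  shows "1 - 5 * real n powr - \<beta> \<le> prob {\<omega> \<in> space M. \<forall>\<sigma>. optimal_ranking n (q \<omega>) \<sigma> \<longrightarrow>
        real_of_int (\<Sum>i = 1..n. \<bar>int (\<sigma> i) - int (\<pi> i)\<bar>) \<le> C * real n \<and>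
        real_of_int (MAX i \<in> {1..n}. \<bar>int (\<sigma> i) - int (\<pi> i)\<bar>) \<le> C * ln (real n)}"
    (is "_ \<le> prob ?G")
proof -
  define C0 where "C0 = 8 * (ln (2 / (1 - exp (- (\<gamma>\<^sup>2 / 8)))) + \<beta>) / \<gamma>\<^sup>2"
  define L where "L = 2 * (\<beta> + 3) / \<gamma>\<^sup>2 * ln (real n)"
  define P where "P = {(a, b). a \<in> {1..n} \<and> b \<in> {1..n} \<and> a < b}"
  \<comment> \<open>\<open>J1\<close> and \<open>J2\<close> serve the single-item moves,
    \<open>J3\<close> the windows across cuts, \<open>J4\<close> the total deviation.\<close>
  define J1 where "J1 = {(a, s, e). 1 \<le> a \<and> a < s \<and> s \<le> e \<and> e \<le> n \<and> L \<le> real (e + 1 - s)}"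
  define E1 :: "nat \<times> nat \<times> nat \<Rightarrow> (nat \<times> nat) set" where "E1 = (\<lambda>(a, s, e). {a} \<times> {s..e})"
  define J2 where "J2 = {(a, s, e). 1 \<le> s \<and> s \<le> e \<and> e < a \<and> a \<le> n \<and> L \<le> real (e + 1 - s)}"
  define E2 :: "nat \<times> nat \<times> nat \<Rightarrow> (nat \<times> nat) set" where "E2 = (\<lambda>(a, s, e). {s..e} \<times> {a})"
  define J3 where "J3 = Sigma {1..n} (\<lambda>m. {(xs, p). set xs \<subseteq> {1..n} \<and> length xs = m \<and> p \<le> n \<and>
        L * real m \<le> real (card (cut_inversions xs p))})"
  define E3 :: "nat \<times> nat list \<times> nat \<Rightarrow> (nat \<times> nat) set" where "E3 = (\<lambda>(m, xs, p). cut_inversions xs p)"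
  define J4 where "J4 = {\<sigma>. \<sigma> permutes {1..n} \<and> C0 * real n < real_of_int (\<Sum>i = 1..n. \<bar>int (\<sigma> i) - int i\<bar>)}"
  define E4 where "E4 \<sigma> = {(a, b). a \<in> {1..n} \<and> b \<in> {1..n} \<and> a < b \<and> \<sigma> b < \<sigma> a}" for \<sigma> :: "nat \<Rightarrow> nat"
  let ?bad = "\<lambda>J E. {\<omega> \<in> space M. \<exists>j \<in> J. \<not> mostly_correct \<omega> (E j)}"
  let ?B1 = "?bad J1 E1" and ?B2 = "?bad J2 E2" and ?B3 = "?bad J3 E3" and ?B4 = "?bad J4 E4"
  let ?\<epsilon> = "real n powr - \<beta>"

  \<comment> \<open>Probabilities of the four bad events\<close>
  have n1: "1 \<le> n" using n by simp
  have J12: "J1 \<subseteq> {1..n} \<times> {1..n} \<times> {1..n}" "J2 \<subseteq> {1..n} \<times> {1..n} \<times> {1..n}"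
    by (auto simp: J1_def J2_def)
  have fin: "finite J1" "finite J2" "finite J3" "finite J4"
  proof -
    show "finite J1" "finite J2"
      using J12 by (auto intro: finite_subset)
    show "finite J3"
      unfolding J3_def
    proof (rule finite_SigmaI)
      show "finite {(xs, p). set xs \<subseteq> {1..n} \<and> length xs = m \<and> p \<le> n \<and>
          L * real m \<le> real (card (cut_inversions xs p))}" for m
        by (rule finite_subset[of _ "{xs. set xs \<subseteq> {1..n} \<and> length xs = m} \<times> {..n}"])
          (auto intro!: finite_lists_length_eq)
    qed simp
    show "finite J4"
      unfolding J4_def by (rule finite_subset[OF _ finite_permutations[of "{1..n}"]]) auto
  qed
  have sub: "\<forall>j\<in>J1. E1 j \<subseteq> P"
    by (auto simp: E1_def J1_def P_def)
  note B1 = prob_ex_not_mostly_correct[of J1 E1, OF fin(1) sub[unfolded P_def] \<gamma>(1)]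
  have sub: "\<forall>j\<in>J2. E2 j \<subseteq> P"
    by (auto simp: E2_def J2_def P_def)
  note B2 = prob_ex_not_mostly_correct[of J2 E2, OF fin(2) sub[unfolded P_def] \<gamma>(1)]
  have sub: "\<forall>j\<in>J3. E3 j \<subseteq> P"
    using cut_inversions_subset[of _ n] unfolding P_def by (auto simp: E3_def J3_def)
  note B3 = prob_ex_not_mostly_correct[of J3 E3, OF fin(3) sub[unfolded P_def] \<gamma>(1)]
  have sub: "\<forall>j\<in>J4. E4 j \<subseteq> P"
    by (auto simp: E4_def P_def)
  note B4 = prob_ex_not_mostly_correct[of J4 E4, OF fin(4) sub[unfolded P_def] \<gamma>(1)]
  have p1: "prob ?B1 \<le> ?\<epsilon>"
    by (rule order_trans[OF B1(2) sum_intervals_le[OF \<gamma>(1) n1 L_def J12(1)]])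
      (auto simp: J1_def E1_def card_cartesian_product)
  have p2: "prob ?B2 \<le> ?\<epsilon>"
    by (rule order_trans[OF B2(2) sum_intervals_le[OF \<gamma>(1) n1 L_def J12(2)]])
      (auto simp: J2_def E2_def card_cartesian_product)
  have p3: "prob ?B3 \<le> 2 * ?\<epsilon>"
  proof -
    have "(\<Sum>j\<in>J3. exp (- (\<gamma>\<^sup>2 * real (card (E3 j)) / 2)))
        = (\<Sum>(m, xs, p)\<in>J3. exp (- (\<gamma>\<^sup>2 * real (card (cut_inversions xs p)) / 2)))"
      by (intro sum.cong refl) (auto simp: E3_def)
    then show ?thesis
      using B3(2) sum_cut_inversions_le[OF \<gamma>(1) n1 \<beta> L_def] unfolding J3_def by linarith
  qed
  have p4: "prob ?B4 \<le> ?\<epsilon>"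
    by (rule order_trans[OF B4(2)], unfold J4_def E4_def)
      (rule sum_far_permutations_le[OF \<gamma>(1) n1 C0_def \<beta>])
  have "prob (?B1 \<union> ?B2 \<union> ?B3 \<union> ?B4) \<le> prob ?B1 + prob ?B2 + prob ?B3 + prob ?B4"
    using measure_Un_le[of "?B1 \<union> ?B2 \<union> ?B3" M ?B4] measure_Un_le[of "?B1 \<union> ?B2" M ?B3]
      measure_Un_le[of ?B1 M ?B2] B1(1) B2(1) B3(1) B4(1) by (smt (verit) sets.Un)
  \<comment> \<open>The shares 1, 1, 2 and 1 of the bad events add up to 5.\<close>
  then have "1 - 5 * ?\<epsilon> \<le> 1 - prob (?B1 \<union> ?B2 \<union> ?B3 \<union> ?B4)"
    using p1 p2 p3 p4 by linarith
  also have "\<dots> = prob (space M - (?B1 \<union> ?B2 \<union> ?B3 \<union> ?B4))"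
    by (rule prob_compl[symmetric]) (use B1(1) B2(1) B3(1) B4(1) in blast)
  also have "\<dots> \<le> prob ?G"
  proof (rule finite_measure_mono[OF _ sets_optimal_event], intro subsetI CollectI conjI allI impI)

    \<comment> \<open>Deterministic bounds outside the bad events\<close>
    fix \<omega> assume mem: "\<omega> \<in> space M - (?B1 \<union> ?B2 \<union> ?B3 \<union> ?B4)"
    then show \<omega>: "\<omega> \<in> space M" by blast
    have good: "\<omega> \<notin> ?B1" "\<omega> \<notin> ?B2" "\<omega> \<notin> ?B3" "\<omega> \<notin> ?B4"
      using mem by blast+
    fix \<sigma> assume opt: "optimal_ranking n (q \<omega>) \<sigma>"
    have correct: "j \<in> J1 \<Longrightarrow> mostly_correct \<omega> (E1 j)" "j \<in> J2 \<Longrightarrow> mostly_correct \<omega> (E2 j)"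
      "k \<in> J3 \<Longrightarrow> mostly_correct \<omega> (E3 k)" "\<tau> \<in> J4 \<Longrightarrow> mostly_correct \<omega> (E4 \<tau>)" for j k \<tau>
      using good \<omega> by blast+
    define \<rho> where "\<rho> = \<sigma> \<circ> inv \<pi>"
    \<comment> \<open>This lets \<open>2 * ln n\<close> absorb the summand 1 of
      \<open>displacement_le\<close>.\<close>
    have ln_n: "1 / 2 \<le> ln (real n)"
    proof -
      have "ln 2 \<le> ln (real n)" using n by simp
      then show ?thesis using ln2_ge_two_thirds by linarith
    qed
    \<comment> \<open>One value serves both thresholds: intervals, and windows per item, both need
      the exponent \<open>\<gamma>\<^sup>2 * L / 2 = (\<beta> + 3) * ln n\<close>.\<close>
    interpret good_table n "relabelled \<omega>" \<rho> \<gamma> L L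
    proof unfold_locales
      show "relabelled \<omega> i j \<in> {1, - 1}" "relabelled \<omega> j i = - relabelled \<omega> i j"
        if "i \<in> {1..n}" "j \<in> {1..n}" "i \<noteq> j" for i j
        using relabelled_values[OF \<omega> that] relabelled_antisym[OF \<omega> that] by auto
      show "optimal_ranking n (relabelled \<omega>) \<rho>"
        unfolding \<rho>_def by (rule optimal_relabelled[OF opt])
      show "0 < \<gamma>" "\<gamma> < 1" using \<gamma> by auto
      show "0 < L" using \<gamma> \<beta> ln_n by (simp add: L_def)
      show "\<gamma> * real (e + 1 - s) < real_of_int (\<Sum>x = s..e. relabelled \<omega> x a)"
        if "1 \<le> a" "a < s" "s \<le> e" "e \<le> n" "L \<le> real (e + 1 - s)" for a s e
        using correct(1)[of "(a, s, e)"] that unfolding J1_def E1_def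
        by (simp only: mem_Collect_eq case_prod_conv mostly_correct_above simp_thms)
      show "\<gamma> * real (e + 1 - s) < real_of_int (\<Sum>x = s..e. relabelled \<omega> a x)"
        if "1 \<le> s" "s \<le> e" "e < a" "a \<le> n" "L \<le> real (e + 1 - s)" for a s e
        using correct(2)[of "(a, s, e)"] that unfolding J2_def E2_def
        by (simp only: mem_Collect_eq case_prod_conv mostly_correct_below simp_thms)
      show "0 < (\<Sum>(a, b)\<in>cut_inversions xs p. relabelled \<omega> b a)"
        if "set xs \<subseteq> {1..n}" "xs \<noteq> []" "length xs \<le> n" "p \<le> n"
          "L * real (length xs) \<le> real (card (cut_inversions xs p))" for xs p
      proof (rule mostly_correct_imp_pos[OF _ \<gamma>(1)])
        have "(length xs, xs, p) \<in> J3"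
          using that by (auto simp: J3_def Suc_le_eq)
        from correct(3)[OF this] show "mostly_correct \<omega> (cut_inversions xs p)"
          by (simp add: E3_def)
      qed
    qed
    have \<pi>_mem: "\<pi> i \<in> {1..n}" if "i \<in> {1..n}" for i
      using permutes_in_image[OF true_order, of i] that by blast
    have \<sigma>_eq: "\<sigma> i = \<rho> (\<pi> i)" for i
      using permutes_inverses[OF true_order] by (simp add: \<rho>_def)
    \<comment> \<open>Were \<open>\<rho>\<close> in \<open>J4\<close>, its inversions would be
      mostly correct and the true order would score higher.\<close>
    have "\<rho> \<notin> J4"
    proof
      assume "\<rho> \<in> J4"
      then have "0 < (\<Sum>(a, b)\<in>E4 \<rho>. relabelled \<omega> b a)"
        by (intro mostly_correct_imp_pos correct(4) \<gamma>)
      also have "\<dots> = (\<Sum>z \<in> E4 \<rho>. - (case z of (a, b) \<Rightarrow> relabelled \<omega> a b))"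
        by (intro sum.cong refl) (auto simp: E4_def intro: anti)
      also have "\<dots> \<le> 0"
        using optimal_sort_all[OF anti opt] by (simp add: sum_negf E4_def)
      finally show False by simp
    qed
    then have "real_of_int (\<Sum>a = 1..n. \<bar>int (\<rho> a) - int a\<bar>) \<le> C0 * real n"
      using perm by (simp add: J4_def)
    also have "(\<Sum>a = 1..n. \<bar>int (\<rho> a) - int a\<bar>) = (\<Sum>i = 1..n. \<bar>int (\<rho> (\<pi> i)) - int (\<pi> i)\<bar>)"
      by (rule sum.reindex_bij_betw[OF permutes_imp_bij[OF true_order], symmetric])
    also have "C0 * real n \<le> C * real n"
      using C1 by (intro mult_right_mono) (auto simp: C0_def)
    finally show "real_of_int (\<Sum>i = 1..n. \<bar>int (\<sigma> i) - int (\<pi> i)\<bar>) \<le> C * real n"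
      by (simp only: \<sigma>_eq)
    have disp: "real_of_int \<bar>int (\<sigma> i) - int (\<pi> i)\<bar> \<le> C * ln (real n)" if i: "i \<in> {1..n}" for i
    proof -
      have L0: "0 < L" by (rule L)
      have "L \<le> 10 * L / \<gamma>"
        using \<gamma> L0 mult_right_mono[of \<gamma> 10 L] by (simp add: field_simps)
      then have "real_of_int \<bar>int (\<sigma> i) - int (\<pi> i)\<bar> \<le> 1 + 4 * (10 * L / \<gamma>) / \<gamma>"
        using displacement_le[OF \<pi>_mem[OF i]] by (simp add: \<sigma>_eq max_def)
      \<comment> \<open>The factor 80 is 4 times 10 times the 2 in \<open>L\<close>, which also
        brings two of the four powers of \<open>\<gamma>\<close>.\<close>
      also have "4 * (10 * L / \<gamma>) / \<gamma> = 80 * (\<beta> + 3) / \<gamma> ^ 4 * ln (real n)"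
        using \<gamma> by (simp add: L_def field_simps power2_eq_square power4_eq_xxxx)
      also have "1 + 80 * (\<beta> + 3) / \<gamma> ^ 4 * ln (real n) \<le> (2 + 80 * (\<beta> + 3) / \<gamma> ^ 4) * ln (real n)"
        using ln_n by (simp add: distrib_right)
      also have "\<dots> \<le> C * ln (real n)"
        using C2 ln_n by (intro mult_right_mono) auto
      finally show ?thesis .
    qed
    have "(MAX i\<in>{1..n}. \<bar>int (\<sigma> i) - int (\<pi> i)\<bar>) \<in> (\<lambda>i. \<bar>int (\<sigma> i) - int (\<pi> i)\<bar>) ` {1..n}"
      using n1 by (intro Max_in) auto
    then show "real_of_int (MAX i\<in>{1..n}. \<bar>int (\<sigma> i) - int (\<pi> i)\<bar>) \<le> C * ln (real n)"
      using disp by auto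
  qed
  finally show ?thesis .
qed

end

theorem theorem2:
  fixes \<gamma> \<beta> :: real
  assumes "0 < \<gamma>" and "\<gamma> < 1 / 2" and "\<beta> > 0"
  shows "\<exists>C K :: real. \<forall>n \<ge> 1. \<forall>(M :: 'a measure) \<pi> q. noisy_sorting M n \<gamma> \<pi> q \<longrightarrow>
    measure M {\<omega> \<in> space M. \<forall>\<sigma>. optimal_ranking n (q \<omega>) \<sigma> \<longrightarrow>
        real_of_int (\<Sum>i = 1..n. \<bar>int (\<sigma> i) - int (\<pi> i)\<bar>) \<le> C * real n \<and>
        real_of_int (MAX i \<in> {1..n}. \<bar>int (\<sigma> i) - int (\<pi> i)\<bar>) \<le> C * ln (real n)}
      \<ge> 1 - K * real n powr (- \<beta>)"
proof -
  \<comment> \<open>The first entry serves the total deviation, the second the maximal one.\<close>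
  define C where "C = max (8 * (ln (2 / (1 - exp (- (\<gamma>\<^sup>2 / 8)))) + \<beta>) / \<gamma>\<^sup>2) (2 + 80 * (\<beta> + 3) / \<gamma> ^ 4)"
  show ?thesis
  proof (rule exI[of _ C], rule exI[of _ 5], intro allI impI)
    fix n :: nat and M :: "'a measure" and \<pi> q
    assume n: "1 \<le> n" and "noisy_sorting M n \<gamma> \<pi> q"
    then interpret noisy_sorting M n \<gamma> \<pi> q by simp
    show "1 - 5 * real n powr (- \<beta>) \<le> measure M {\<omega> \<in> space M. \<forall>\<sigma>. optimal_ranking n (q \<omega>) \<sigma> \<longrightarrow>
        real_of_int (\<Sum>i = 1..n. \<bar>int (\<sigma> i) - int (\<pi> i)\<bar>) \<le> C * real n \<and>
        real_of_int (MAX i \<in> {1..n}. \<bar>int (\<sigma> i) - int (\<pi> i)\<bar>) \<le> C * ln (real n)}"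
    proof (cases "n = 1")
      case True
      \<comment> \<open>At \<open>n = 1\<close> the logarithm vanishes and cannot absorb constants,
        but the required lower bound is \<open>1 - 5\<close>.\<close>
      have "1 - 5 * real n powr (- \<beta>) \<le> 0"
        using True by simp
      then show ?thesis
        using measure_nonneg order_trans by blast
    next
      case False
      then show ?thesis
        using n assms by (intro prob_optimal_close) (auto simp: C_def)
    qed
  qed
qed

end
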